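(* Let $B$ be a unital associative algebra over a field $F$, and let $\beta$ be a filtration on $B$. (1) $\beta$ is tame if and only if $\beta\sim\alpha\cap B$, where $\alpha$ is a degree filtration on a unital $2$-generator associative algebra $A$ in which $B$ is embedded as a subalgebra. (2) $\beta$ is tame if and only if $\beta=\alpha\cap B$, where $\alpha$ is a degree filtration on a unital finitely generated associative algebra $A$ in which $B$ is embedded as a subalgebra.
   Context: A filtration on an algebra $B$ is a sequence $\beta=\{B_n\}_{n\ge 0}$ of finite-dimensional subspaces $B_0\subset B_1\subset\cdots$ with $\bigcup_n B_n=B$ and $B_kB_l\subset B_{k+l}$ for all $k,l\ge 0$. A filtration is tame if there is $c>0$ with $\dim B_n<c^n$ for all $n\ge 1$. The degree filtration of a unital associative algebra $A$ generated by a finite set $X$ is $\alpha=\{A_n\}$, where $A_n$ is the linear span of all products of at most $n$ elements of $X$ (the empty product being $1$, so $A_0=\mathrm{Span}\{1\}$). For a subalgebra $B\subset A$ and a filtration $\alpha=\{A_n\}$ of $A$, $\alpha\cap B=\{A_n\cap B\}$. For filtrations $\beta=\{B_n\}$, $\beta'=\{B'_n\}$ on $B$, $\beta\sim\beta'$ means that there is an integer $t>0$ with $B_n\subset B'_{tn}$ and $B'_n\subset B_{tn}$ for all $n\ge 0$.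
   Formalization: The formal theorem adds the hypothesis that B_0 is contained in Span{1}; without it the claim fails, e.g. for B = F×F with B_n = B for all n, which is tame although A_0∩B is at most one-dimensional. The embedding of B in A is not required to preserve the unit. *)

theory Defs
  imports Complex_Main "Jordan_Normal_Form.Missing_VectorSpace"
begin

text \<open>
  The locale \<open>algebra\<close> of HOL-Algebra requires the multiplication to be commutative, so unital
  associative algebras are introduced here. The zero algebra is not excluded.
\<close>

locale assoc_algebra = vectorspace F A + ring A
  for F :: "('f, 'm) ring_scheme" and A :: "('f, 'a, 'n) module_scheme" +
  assumes smult_mult_left:
      "\<lbrakk>c \<in> carrier F; x \<in> carrier A; y \<in> carrier A\<rbrakk> \<Longrightarrow>
        (c \<odot>\<^bsub>A\<^esub> x) \<otimes>\<^bsub>A\<^esub> y = c \<odot>\<^bsub>A\<^esub> (x \<otimes>\<^bsub>A\<^esub> y)"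
    and smult_mult_right:
      "\<lbrakk>c \<in> carrier F; x \<in> carrier A; y \<in> carrier A\<rbrakk> \<Longrightarrow>
        x \<otimes>\<^bsub>A\<^esub> (c \<odot>\<^bsub>A\<^esub> y) = c \<odot>\<^bsub>A\<^esub> (x \<otimes>\<^bsub>A\<^esub> y)"

definition filtration ::
  "('f, 'm) ring_scheme \<Rightarrow> ('f, 'b, 'n) module_scheme \<Rightarrow> (nat \<Rightarrow> 'b set) \<Rightarrow> bool" where
  "filtration F B \<beta> \<longleftrightarrow>
     (\<forall>n. subspace F (\<beta> n) B \<and> vectorspace.fin_dim F (B\<lparr>carrier := \<beta> n\<rparr>)) \<and>
     (\<forall>n. \<beta> n \<subseteq> \<beta> (Suc n)) \<and>
     (\<Union>n. \<beta> n) = carrier B \<and>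
     (\<forall>k l. \<forall>x \<in> \<beta> k. \<forall>y \<in> \<beta> l. x \<otimes>\<^bsub>B\<^esub> y \<in> \<beta> (k + l))"

definition tame ::
  "('f, 'm) ring_scheme \<Rightarrow> ('f, 'b, 'n) module_scheme \<Rightarrow> (nat \<Rightarrow> 'b set) \<Rightarrow> bool" where
  "tame F B \<beta> \<longleftrightarrow>
     (\<exists>c::real. c > 0 \<and> (\<forall>n\<ge>1. real (vectorspace.dim F (B\<lparr>carrier := \<beta> n\<rparr>)) < c ^ n))"

definition filtration_equiv :: "(nat \<Rightarrow> 'b set) \<Rightarrow> (nat \<Rightarrow> 'b set) \<Rightarrow> bool" where
  "filtration_equiv \<beta> \<beta>' \<longleftrightarrow>
     (\<exists>t::nat. t > 0 \<and> (\<forall>n. \<beta> n \<subseteq> \<beta>' (t * n) \<and> \<beta>' n \<subseteq> \<beta> (t * n)))"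

definition unital_subalgebra ::
  "('f, 'm) ring_scheme \<Rightarrow> 'a set \<Rightarrow> ('f, 'a, 'n) module_scheme \<Rightarrow> bool" where
  "unital_subalgebra F S A \<longleftrightarrow>
     subspace F S A \<and> \<one>\<^bsub>A\<^esub> \<in> S \<and> (\<forall>x \<in> S. \<forall>y \<in> S. x \<otimes>\<^bsub>A\<^esub> y \<in> S)"

definition alg_generated_by ::
  "('f, 'm) ring_scheme \<Rightarrow> ('f, 'a, 'n) module_scheme \<Rightarrow> 'a set \<Rightarrow> bool" where
  "alg_generated_by F A X \<longleftrightarrow>
     X \<subseteq> carrier A \<and> (\<forall>S. unital_subalgebra F S A \<and> X \<subseteq> S \<longrightarrow> S = carrier A)"

definition degree_filtration ::
  "('f, 'm) ring_scheme \<Rightarrow> ('f, 'a, 'n) module_scheme \<Rightarrow> 'a set \<Rightarrow> nat \<Rightarrow> 'a set" where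
  "degree_filtration F A X n =
     module.span F A {foldr (\<otimes>\<^bsub>A\<^esub>) xs \<one>\<^bsub>A\<^esub> | xs. set xs \<subseteq> X \<and> length xs \<le> n}"

text \<open>
  An embedding of \<open>B\<close> as a subalgebra of \<open>A\<close>: the image is a subspace closed under
  multiplication. Preservation of the unit is not demanded; it is automatic as soon as the unit of
  a nonzero \<open>B\<close> lies in degree 0 of \<open>A\<close>, see \<open>alg_embedding_one\<close>.
\<close>

definition alg_embedding ::
  "('f, 'm) ring_scheme \<Rightarrow> ('f, 'b, 'n) module_scheme \<Rightarrow> ('f, 'a, 'k) module_scheme
    \<Rightarrow> ('b \<Rightarrow> 'a) \<Rightarrow> bool" where
  "alg_embedding F B A \<phi> \<longleftrightarrow>
     \<phi> \<in> module_hom F B A \<and> inj_on \<phi> (carrier B) \<and>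
     (\<forall>x \<in> carrier B. \<forall>y \<in> carrier B. \<phi> (x \<otimes>\<^bsub>B\<^esub> y) = \<phi> x \<otimes>\<^bsub>A\<^esub> \<phi> y)"

text \<open>The filtration \<open>\<alpha> \<inter> B\<close>, with \<open>B\<close> identified with its image under \<open>\<phi>\<close>.\<close>

definition restrict_filtration ::
  "('b, 'n) ring_scheme \<Rightarrow> ('b \<Rightarrow> 'a) \<Rightarrow> (nat \<Rightarrow> 'a set) \<Rightarrow> nat \<Rightarrow> 'b set" where
  "restrict_filtration B \<phi> \<alpha> n = {b \<in> carrier B. \<phi> b \<in> \<alpha> n}"

definition equiv_restriction_2_generator ::
  "('f, 'm) ring_scheme \<Rightarrow> ('f, 'b, 'n) module_scheme \<Rightarrow> (nat \<Rightarrow> 'b set)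
    \<Rightarrow> ('f, 'a, 'k) module_scheme \<Rightarrow> bool" where
  "equiv_restriction_2_generator F B \<beta> A \<longleftrightarrow>
     assoc_algebra F A \<and>
     (\<exists>\<phi> x y. alg_embedding F B A \<phi> \<and> alg_generated_by F A {x, y} \<and>
        filtration_equiv \<beta> (restrict_filtration B \<phi> (degree_filtration F A {x, y})))"

definition eq_restriction_fin_gen ::
  "('f, 'm) ring_scheme \<Rightarrow> ('f, 'b, 'n) module_scheme \<Rightarrow> (nat \<Rightarrow> 'b set)
    \<Rightarrow> ('f, 'a, 'k) module_scheme \<Rightarrow> bool" where
  "eq_restriction_fin_gen F B \<beta> A \<longleftrightarrow>
     assoc_algebra F A \<and>
     (\<exists>\<phi> X. alg_embedding F B A \<phi> \<and> finite X \<and> alg_generated_by F A X \<and>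
        \<beta> = restrict_filtration B \<phi> (degree_filtration F A X))"

text \<open>
  HOL cannot quantify existentially over the carrier type of the ambient algebra \<open>A\<close>. A finitely
  generated algebra has countable dimension over \<open>F\<close>, so it is isomorphic to one whose carrier is a
  set of functions \<open>nat \<Rightarrow> 'f\<close> (finitely supported coordinate vectors). Existence claims
  about \<open>A\<close> may therefore be made for the carrier type \<open>nat \<Rightarrow> 'f\<close>.
\<close>

lemma degree_filtration_0:
  "degree_filtration F A X 0 = module.span F A {\<one>\<^bsub>A\<^esub>}"
proof -
  have "{foldr (\<otimes>\<^bsub>A\<^esub>) xs \<one>\<^bsub>A\<^esub> | xs. set xs \<subseteq> X \<and> length xs \<le> 0} = {\<one>\<^bsub>A\<^esub>}"
    by auto
  then show ?thesis
    by (simp only: degree_filtration_def)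
qed

lemma (in vectorspace) inv_smult_cancel:
  assumes "a \<in> carrier K" "a \<noteq> \<zero>\<^bsub>K\<^esub>" "x \<in> carrier V"
  shows "inv\<^bsub>K\<^esub> a \<in> carrier K" "inv\<^bsub>K\<^esub> a \<odot>\<^bsub>V\<^esub> (a \<odot>\<^bsub>V\<^esub> x) = x"
proof -
  have u: "inv\<^bsub>K\<^esub> a \<in> carrier K" "inv\<^bsub>K\<^esub> a \<otimes>\<^bsub>K\<^esub> a = \<one>\<^bsub>K\<^esub>"
    using assms field_Units by auto
  show "inv\<^bsub>K\<^esub> a \<in> carrier K" by (rule u)
  show "inv\<^bsub>K\<^esub> a \<odot>\<^bsub>V\<^esub> (a \<odot>\<^bsub>V\<^esub> x) = x"
    using assms u by (simp flip: smult_assoc1)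
qed

lemma (in vectorspace) span_singletonE:
  assumes "x \<in> span {v}" "v \<in> carrier V"
  obtains a where "a \<in> carrier K" "x = a \<odot>\<^bsub>V\<^esub> v"
  using assms by (subst (asm) finite_span) (auto simp: lincomb_def)

text \<open>
  Degree 0 of any restricted degree filtration lies in \<open>F\<cdot>1\<close>. Since both \<open>\<beta> \<sim> \<alpha> \<inter> B\<close> and
  \<open>\<beta> = \<alpha> \<inter> B\<close> force \<open>\<beta>\<close> and \<open>\<alpha> \<inter> B\<close> to agree in degree 0, whereas tameness does not
  constrain degree 0 at all, a filtration with \<open>\<beta> 0\<close> not contained in \<open>F\<cdot>1\<close> has to be excluded.
\<close>

lemma restrict_degree_filtration_0:
  fixes B (structure)
  assumes A: "assoc_algebra F A" and B: "assoc_algebra F B" and emb: "alg_embedding F B A \<phi>"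
  shows "restrict_filtration B \<phi> (degree_filtration F A X) 0 \<subseteq> module.span F B {\<one>}"
proof
  interpret A: assoc_algebra F A by (rule A)
  interpret B: assoc_algebra F B by (rule B)
  have hom: "\<phi> \<in> module_hom F B A" and inj: "inj_on \<phi> (carrier B)"
    and mult: "\<And>x y. x \<in> carrier B \<Longrightarrow> y \<in> carrier B \<Longrightarrow> \<phi> (x \<otimes> y) = \<phi> x \<otimes>\<^bsub>A\<^esub> \<phi> y"
    using emb by (auto simp: alg_embedding_def)
  have closed: "\<phi> x \<in> carrier A" if "x \<in> carrier B" for x
    using hom that by (auto simp: module_hom_def)
  have smult: "\<phi> (c \<odot> x) = c \<odot>\<^bsub>A\<^esub> \<phi> x" if "c \<in> carrier F" "x \<in> carrier B" for c x
    using hom that by (auto simp: module_hom_def)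
  have zero: "\<phi> \<zero> = \<zero>\<^bsub>A\<^esub>"
    using smult[of "\<zero>\<^bsub>F\<^esub>" \<zero>] closed[of \<zero>] by simp
  fix x assume "x \<in> restrict_filtration B \<phi> (degree_filtration F A X) 0"
  then have x: "x \<in> carrier B" and "\<phi> x \<in> A.span {\<one>\<^bsub>A\<^esub>}"
    by (auto simp: restrict_filtration_def degree_filtration_0)
  then obtain a where a: "a \<in> carrier F" "\<phi> x = a \<odot>\<^bsub>A\<^esub> \<one>\<^bsub>A\<^esub>"
    by (auto elim: A.span_singletonE)
  show "x \<in> B.span {\<one>}"
  proof (cases "a = \<zero>\<^bsub>F\<^esub>")
    case True
    then have "\<phi> x = \<phi> \<zero>" using a zero by simp
    then have "x = \<zero>" using inj_onD[OF inj, of x \<zero>] x by simp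
    then show ?thesis using B.span_zero by simp
  next
    case False
    define e where "e = inv\<^bsub>F\<^esub> a \<odot> x"
    have e: "e \<in> carrier B"
      using x A.inv_smult_cancel(1)[OF a(1) False, of "\<one>\<^bsub>A\<^esub>"] by (simp add: e_def)
    have "\<phi> e = \<one>\<^bsub>A\<^esub>"
      using A.inv_smult_cancel[OF a(1) False, of "\<one>\<^bsub>A\<^esub>"] x a by (simp add: e_def smult)
    then have "\<phi> (e \<otimes> \<one>) = \<phi> \<one>"
      using mult[OF e B.one_closed] closed[of \<one>] by simp
    then have "e = \<one>"
      using inj_onD[OF inj, of "e \<otimes> \<one>" \<one>] e by simp
    then have "a \<odot> \<one> = a \<odot> (inv\<^bsub>F\<^esub> a \<odot> x)"
      by (simp add: e_def)
    also have "\<dots> = x"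
      using B.inv_smult_cancel[OF a(1) False x] x a(1) False B.smult_assoc1 
      by (metis A.R.m_comm B.smult_one A.inv_smult_cancel(1) B.smult_assoc1)
    finally have "x = a \<odot> \<one>" by simp
    moreover have "a \<odot> \<one> \<in> B.span {\<one>}"
      using a(1) by (subst B.finite_span) (auto simp: B.lincomb_def intro!: exI[of _ "\<lambda>_. a"])
    ultimately show ?thesis by simp
  qed
qed

lemma alg_embedding_one:
  fixes B (structure)
  assumes A: "assoc_algebra F A" and B: "assoc_algebra F B" and emb: "alg_embedding F B A \<phi>"
    and nz: "\<one> \<noteq> \<zero>"
    and deg0: "\<phi> \<one> \<in> degree_filtration F A X 0"
  shows "\<phi> \<one> = \<one>\<^bsub>A\<^esub>"
proof -
  interpret A: assoc_algebra F A by (rule A)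
  interpret B: assoc_algebra F B by (rule B)
  have hom: "\<phi> \<in> module_hom F B A" and inj: "inj_on \<phi> (carrier B)"
    using emb by (auto simp: alg_embedding_def)
  have eA: "\<phi> \<one> \<in> carrier A"
    using hom by (auto simp: module_hom_def)
  have "\<phi> \<one> \<in> A.span {\<one>\<^bsub>A\<^esub>}"
    using deg0 by (simp add: degree_filtration_0)
  then obtain a where a: "a \<in> carrier F" and e: "\<phi> \<one> = a \<odot>\<^bsub>A\<^esub> \<one>\<^bsub>A\<^esub>"
    by (auto elim: A.span_singletonE)
  have "a \<odot>\<^bsub>A\<^esub> \<phi> \<one> = \<phi> \<one> \<otimes>\<^bsub>A\<^esub> \<phi> \<one>"
    using a e eA A.smult_mult_left[of a "\<one>\<^bsub>A\<^esub>" "\<phi> \<one>"] by simp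
  also have "\<dots> = \<phi> (\<one> \<otimes> \<one>)"
    using emb B.one_closed unfolding alg_embedding_def by metis
  also have "\<dots> = \<phi> \<one>"
    by simp
  finally have idem: "a \<odot>\<^bsub>A\<^esub> \<phi> \<one> = \<phi> \<one>" .
  have zero: "\<phi> \<zero> = \<zero>\<^bsub>A\<^esub>"
  proof -
    have "\<phi> (\<zero>\<^bsub>F\<^esub> \<odot> \<zero>) = \<zero>\<^bsub>F\<^esub> \<odot>\<^bsub>A\<^esub> \<phi> \<zero>" "\<phi> \<zero> \<in> carrier A"
      using hom unfolding module_hom_def by blast+
    then show ?thesis by simp
  qed
  have "a \<noteq> \<zero>\<^bsub>F\<^esub>"
    using idem eA zero nz inj_onD[OF inj, of \<one> \<zero>] by auto
  then show ?thesis
    using idem e eA a A.inv_smult_cancel(2)[OF a, of "\<phi> \<one>"] A.inv_smult_cancel(2)[OF a, of "\<one>\<^bsub>A\<^esub>"]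
    by simp
qed

end

theory Submission
  imports Defs "HOL-Library.Countable_Set"
begin

text \<open>
  A degree filtration with finite generating set \<open>X\<close> is tame for a trivial reason: its \<open>n\<close>-th term is
  spanned by the words of length at most \<open>n\<close>, of which there are at most \<open>(|X| + 1)^n\<close>. Restricting
  to a subspace and rescaling \<open>n\<close> to \<open>t n\<close> keeps an exponential bound
  (\<open>tame_if_dominated_by_degree_filtration\<close>).

  For the converse, tameness provides a \<open>k\<close> such that \<open>\<beta> n\<close> is spanned by at most \<open>k^n\<close> elements, which
  can therefore be written \<open>g ds\<close> with \<open>ds\<close> a string of \<open>n\<close> digits below \<open>k\<close>
  (\<open>tame_spanning_family\<close>). Each \<open>ds\<close> is encoded by a codeword over a finite alphabet, and an algebra
  is needed in which the product of the letters of the codeword equals \<open>g ds\<close>, while nothing in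
  \<open>B\<close> becomes expressible by words that are too short. Presenting this algebra by generators and
  relations would require a confluence argument. Instead it is realised concretely by operators.
  Let \<open>M\<close> be a left \<open>B\<close>-module and \<open>V\<close> the space of all functions from words (regarded as stacks of
  letters) to \<open>M\<close>. The letter \<open>a\<close> acts on \<open>f\<close> by looking at the stack \<open>a # u\<close>: if it starts with a
  codeword, say that of \<open>ds\<close>, followed by \<open>v\<close>, then the value is \<open>g ds \<cdot> f v\<close>, otherwise it is
  \<open>f (a # u)\<close>. If no codeword overlaps another one or itself, then the letters of a codeword just pile
  up until the codeword is complete, so that their product is pointwise multiplication by \<open>g ds\<close>
  (\<open>codeword_op\<close>). Hence \<open>B\<close>, acting pointwise, lies in the algebra generated by the letters.

  The upper bound on \<open>B \<inter> A\<^sub>n\<close> comes from a weight: with \<open>M\<close> filtered by \<open>\<mu>\<close>, call \<open>f\<close> of weight \<open>j\<close> if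
  \<open>f u \<in> \<mu> (j + |u|)\<close> for all stacks \<open>u\<close>. A letter raises the weight by at most one, because erasing a
  codeword of length at least \<open>deg g\<close> shortens the stack by as much as multiplication by \<open>g\<close> can
  raise the degree (\<open>degree_raises_weight\<close>). Applied to a constant function of weight \<open>0\<close> and the
  empty stack this shows \<open>B \<inter> A\<^sub>n \<subseteq> \<beta> n\<close>.

  When \<open>1 \<in> \<beta> 0\<close>, the regular module \<open>M = B\<close> does the job. Otherwise \<open>\<beta> 0 = 0\<close>, so \<open>1\<close> must not become
  the unit of \<open>A\<close>, and a module is used on which \<open>1\<close> acts as a proper idempotent. Finally, two codes
  are supplied: one whose codewords have length exactly \<open>n\<close>, over a large finite alphabet, which gives
  equality of filtrations, and one over a two-letter alphabet, with codewords of length at most \<open>t n\<close>,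
  which gives equivalence. Since the algebra has a countable spanning set, its elements can be
  encoded as functions \<open>nat \<Rightarrow> 'f\<close> (\<open>countable_realization\<close>).
\<close>

section \<open>Degree filtrations\<close>

context assoc_algebra
begin

lemma foldr_mult_closed:
  "set xs \<subseteq> carrier A \<Longrightarrow> foldr (\<otimes>\<^bsub>A\<^esub>) xs \<one>\<^bsub>A\<^esub> \<in> carrier A"
  by (induction xs) auto

lemma foldr_mult_append:
  "set xs \<subseteq> carrier A \<Longrightarrow> set ys \<subseteq> carrier A \<Longrightarrow>
    foldr (\<otimes>\<^bsub>A\<^esub>) (xs @ ys) \<one>\<^bsub>A\<^esub> = foldr (\<otimes>\<^bsub>A\<^esub>) xs \<one>\<^bsub>A\<^esub> \<otimes>\<^bsub>A\<^esub> foldr (\<otimes>\<^bsub>A\<^esub>) ys \<one>\<^bsub>A\<^esub>"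
  by (induction xs) (auto simp: foldr_mult_closed m_assoc)

lemma subspaceI:
  assumes "S \<subseteq> carrier A" "\<zero>\<^bsub>A\<^esub> \<in> S"
    "\<And>x y. x \<in> S \<Longrightarrow> y \<in> S \<Longrightarrow> x \<oplus>\<^bsub>A\<^esub> y \<in> S"
    "\<And>c x. c \<in> carrier F \<Longrightarrow> x \<in> S \<Longrightarrow> c \<odot>\<^bsub>A\<^esub> x \<in> S"
  shows "subspace F S A"
  using assms vectorspace_axioms module_axioms
  by (auto simp: subspace_def submodule_def)

lemma degree_filtration_subspace:
  assumes "X \<subseteq> carrier A"
  shows "subspace F (degree_filtration F A X n) A"
  unfolding degree_filtration_def
  using assms by (intro span_is_subspace) (auto intro!: foldr_mult_closed)

lemma degree_filtration_mono:
  "m \<le> n \<Longrightarrow> degree_filtration F A X m \<subseteq> degree_filtration F A X n"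
  unfolding degree_filtration_def by (intro span_is_monotone) force

lemma word_in_degree_filtration:
  assumes "X \<subseteq> carrier A" "set xs \<subseteq> X" "length xs \<le> n"
  shows "foldr (\<otimes>\<^bsub>A\<^esub>) xs \<one>\<^bsub>A\<^esub> \<in> degree_filtration F A X n"
proof -
  let ?W = "{foldr (\<otimes>\<^bsub>A\<^esub>) xs \<one>\<^bsub>A\<^esub> | xs. set xs \<subseteq> X \<and> length xs \<le> n}"
  have "?W \<subseteq> span ?W"
    using assms by (intro in_own_span) (auto intro!: foldr_mult_closed)
  then show ?thesis using assms unfolding degree_filtration_def by blast
qed

lemma degree_filtration_least:
  assumes "subspace F S A"
    and "\<And>xs. set xs \<subseteq> X \<Longrightarrow> length xs \<le> n \<Longrightarrow> foldr (\<otimes>\<^bsub>A\<^esub>) xs \<one>\<^bsub>A\<^esub> \<in> S"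
  shows "degree_filtration F A X n \<subseteq> S"
  unfolding degree_filtration_def
  using assms by (intro span_is_subset) (auto simp: subspace_def)

lemma subspaceD:
  assumes "subspace F S A"
  shows "S \<subseteq> carrier A" "\<zero>\<^bsub>A\<^esub> \<in> S" "x \<in> S \<Longrightarrow> y \<in> S \<Longrightarrow> x \<oplus>\<^bsub>A\<^esub> y \<in> S"
    "c \<in> carrier F \<Longrightarrow> x \<in> S \<Longrightarrow> c \<odot>\<^bsub>A\<^esub> x \<in> S"
  using assms by (auto simp: subspace_def submodule_def)

text \<open>
  By bilinearity the claim reduces to products of two words, which are concatenated: the sets of left
  and of right factors satisfying it are subspaces containing the relevant words.
\<close>

lemma degree_filtration_mult:
  assumes X: "X \<subseteq> carrier A"
    and x: "x \<in> degree_filtration F A X m" and y: "y \<in> degree_filtration F A X n"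
  shows "x \<otimes>\<^bsub>A\<^esub> y \<in> degree_filtration F A X (m + n)"
proof -
  let ?D = "degree_filtration F A X"
  have sub: "subspace F (?D k) A" for k
    using X by (rule degree_filtration_subspace)
  note D = subspaceD[OF sub]
  let ?S = "{x \<in> carrier A. \<forall>ys. set ys \<subseteq> X \<longrightarrow> length ys \<le> n \<longrightarrow> x \<otimes>\<^bsub>A\<^esub> foldr (\<otimes>\<^bsub>A\<^esub>) ys \<one>\<^bsub>A\<^esub> \<in> ?D (m + n)}"
  have cl: "foldr (\<otimes>\<^bsub>A\<^esub>) ys \<one>\<^bsub>A\<^esub> \<in> carrier A" if "set ys \<subseteq> X" for ys
    using that X by (intro foldr_mult_closed) auto
  have "?D m \<subseteq> ?S"
  proof (rule degree_filtration_least)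
    show "subspace F ?S A"
      by (rule subspaceI) (auto simp: cl l_distr smult_mult_left intro!: D(2-4))
    fix xs assume xs: "set xs \<subseteq> X" "length xs \<le> m"
    have "foldr (\<otimes>\<^bsub>A\<^esub>) (xs @ ys) \<one>\<^bsub>A\<^esub> \<in> ?D (m + n)" if "set ys \<subseteq> X" "length ys \<le> n" for ys
      using X xs that by (intro word_in_degree_filtration) auto
    then show "foldr (\<otimes>\<^bsub>A\<^esub>) xs \<one>\<^bsub>A\<^esub> \<in> ?S"
      using xs X cl foldr_mult_append[OF subset_trans[OF xs(1) X] subset_trans[OF _ X]] by auto
  qed
  then have xS: "x \<in> ?S" using x by blast
  let ?R = "{y \<in> carrier A. x \<otimes>\<^bsub>A\<^esub> y \<in> ?D (m + n)}"
  have "?D n \<subseteq> ?R"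
  proof (rule degree_filtration_least)
    show "subspace F ?R A"
      using xS by (intro subspaceI) (auto simp: r_distr smult_mult_right intro!: D(2-4))
  qed (use xS cl in auto)
  then show ?thesis using y by blast
qed

lemma Union_degree_filtration_subalgebra:
  assumes X: "X \<subseteq> carrier A"
  shows "unital_subalgebra F (\<Union>n. degree_filtration F A X n) A"
proof -
  let ?D = "degree_filtration F A X"
  note D = subspaceD[OF degree_filtration_subspace[OF X]]
  have "subspace F (\<Union>n. ?D n) A"
  proof (rule subspaceI)
    fix x y assume "x \<in> (\<Union>n. ?D n)" "y \<in> (\<Union>n. ?D n)"
    then obtain m n where mn: "x \<in> ?D m" "y \<in> ?D n" by blast
    then have "x \<in> ?D (m + n)" "y \<in> ?D (m + n)"
      using degree_filtration_mono[of m "m + n" X] degree_filtration_mono[of n "m + n" X] by auto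
    then show "x \<oplus>\<^bsub>A\<^esub> y \<in> (\<Union>n. ?D n)" using D(3) by blast
  next
    show "(\<Union>n. ?D n) \<subseteq> carrier A" using D(1) by (rule UN_least)
    show "\<zero>\<^bsub>A\<^esub> \<in> (\<Union>n. ?D n)" using D(2)[of 0] by blast
    show "c \<odot>\<^bsub>A\<^esub> x \<in> (\<Union>n. ?D n)" if "c \<in> carrier F" "x \<in> (\<Union>n. ?D n)" for c x
      using that D(4) by blast
  qed
  moreover have "\<one>\<^bsub>A\<^esub> \<in> ?D 0"
    using word_in_degree_filtration[OF X, of "[]" 0] by simp
  ultimately show ?thesis
    unfolding unital_subalgebra_def using degree_filtration_mult[OF X] by blast
qed

lemma alg_generated_byI:
  assumes X: "X \<subseteq> carrier A" and "(\<Union>n. degree_filtration F A X n) = carrier A"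
  shows "alg_generated_by F A X"
  unfolding alg_generated_by_def
proof (intro conjI X allI impI)
  fix S assume S: "unital_subalgebra F S A \<and> X \<subseteq> S"
  then have sub: "subspace F S A" by (simp add: unital_subalgebra_def)
  have "foldr (\<otimes>\<^bsub>A\<^esub>) xs \<one>\<^bsub>A\<^esub> \<in> S" if "set xs \<subseteq> X" for xs
    using that S by (induction xs) (auto simp: unital_subalgebra_def)
  then have "degree_filtration F A X n \<subseteq> S" for n
    by (intro degree_filtration_least sub)
  then show "S = carrier A" using assms(2) subspaceD(1)[OF sub] by blast
qed

end

lemma module_hom_span:
  assumes V: "module K V" and W: "module K W" and f: "f \<in> module_hom K V W" and S: "S \<subseteq> carrier V"
  shows "f ` module.span K V S = module.span K W (f ` S)"
proof
  interpret V: module K V by fact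
  interpret W: module K W by fact
  interpret f: mod_hom K V W f by unfold_locales (rule f)
  have fS: "f ` S \<subseteq> carrier W" using S by auto
  have subV: "submodule K (V.span S) V" and subW: "submodule K (W.span (f ` S)) W"
    using S fS by (auto intro: V.span_is_submodule W.span_is_submodule)
  have "V.span S \<subseteq> {x \<in> carrier V. f x \<in> W.span (f ` S)}"
  proof (rule V.span_is_subset)
    show "S \<subseteq> {x \<in> carrier V. f x \<in> W.span (f ` S)}"
      using S W.in_own_span[OF fS] by auto
    show "submodule K {x \<in> carrier V. f x \<in> W.span (f ` S)} V"
      using subW V by (auto simp: submodule_def)
  qed
  then show "f ` V.span S \<subseteq> W.span (f ` S)" by blast
  show "W.span (f ` S) \<subseteq> f ` V.span S"
  proof (rule W.span_is_subset)
    show "f ` S \<subseteq> f ` V.span S"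
      using V.in_own_span[OF S] by blast
    have cl: "V.span S \<subseteq> carrier V" using subV by (simp add: submodule_def)
    show "submodule K (f ` V.span S) W"
    proof (unfold_locales)
      show "f ` V.span S \<subseteq> carrier W" using cl by auto
      fix v w assume "v \<in> f ` V.span S" "w \<in> f ` V.span S"
      then obtain x y where "x \<in> V.span S" "y \<in> V.span S" "v = f x" "w = f y" by blast
      then show "v \<oplus>\<^bsub>W\<^esub> w \<in> f ` V.span S"
        using cl subV by (intro image_eqI[of _ _ "x \<oplus>\<^bsub>V\<^esub> y"]) (auto simp: submodule_def module_hom_add[OF f] subsetD)
    next
      show "\<zero>\<^bsub>W\<^esub> \<in> f ` V.span S"
        using subV by (intro image_eqI[of _ _ "\<zero>\<^bsub>V\<^esub>"]) (auto simp: submodule_def)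
    next
      fix c v assume c: "c \<in> carrier K" and "v \<in> f ` V.span S"
      then obtain x where "x \<in> V.span S" "v = f x" by blast
      then show "c \<odot>\<^bsub>W\<^esub> v \<in> f ` V.span S"
        using cl subV c by (intro image_eqI[of _ _ "c \<odot>\<^bsub>V\<^esub> x"]) (auto simp: submodule_def module_hom_smult[OF f] subsetD)
    qed
  qed
qed

text \<open>
  Used for a homomorphism that is injective but not surjective: it lets the degree filtration
  of a copy of a subalgebra be computed inside the larger algebra.
\<close>

lemma alg_hom_degree_filtration:
  assumes A: "assoc_algebra F A" and R: "assoc_algebra F R" and k: "k \<in> module_hom F A R"
    and one: "k \<one>\<^bsub>A\<^esub> = \<one>\<^bsub>R\<^esub>"
    and mult: "\<And>x y. x \<in> carrier A \<Longrightarrow> y \<in> carrier A \<Longrightarrow> k (x \<otimes>\<^bsub>A\<^esub> y) = k x \<otimes>\<^bsub>R\<^esub> k y"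
    and Y: "Y \<subseteq> carrier A"
  shows "k ` degree_filtration F A Y n = degree_filtration F R (k ` Y) n"
proof -
  interpret A: assoc_algebra F A by fact
  interpret R: assoc_algebra F R by fact
  have word: "k (foldr (\<otimes>\<^bsub>A\<^esub>) xs \<one>\<^bsub>A\<^esub>) = foldr (\<otimes>\<^bsub>R\<^esub>) (map k xs) \<one>\<^bsub>R\<^esub>" if "set xs \<subseteq> Y" for xs
    using that
  proof (induction xs)
    case (Cons a xs)
    then have "a \<in> carrier A" "foldr (\<otimes>\<^bsub>A\<^esub>) xs \<one>\<^bsub>A\<^esub> \<in> carrier A"
      using Y by (auto intro!: A.foldr_mult_closed)
    then show ?case using Cons by (simp add: mult)
  qed (simp add: one)
  have img: "k ` {foldr (\<otimes>\<^bsub>A\<^esub>) xs \<one>\<^bsub>A\<^esub> | xs. set xs \<subseteq> Y \<and> length xs \<le> n}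
      = {foldr (\<otimes>\<^bsub>R\<^esub>) xs \<one>\<^bsub>R\<^esub> | xs. set xs \<subseteq> k ` Y \<and> length xs \<le> n}" (is "k ` ?L = ?R")
  proof
    show "k ` ?L \<subseteq> ?R"
    proof
      fix z assume "z \<in> k ` ?L"
      then obtain xs where xs: "set xs \<subseteq> Y" "length xs \<le> n" "z = k (foldr (\<otimes>\<^bsub>A\<^esub>) xs \<one>\<^bsub>A\<^esub>)" by blast
      then have "set (map k xs) \<subseteq> k ` Y" "length (map k xs) \<le> n" by auto
      then show "z \<in> ?R" unfolding xs(3) word[OF xs(1)] by blast
    qed
    show "?R \<subseteq> k ` ?L"
    proof
      fix z assume "z \<in> ?R"
      then obtain ys where ys: "set ys \<subseteq> k ` Y" "length ys \<le> n" "z = foldr (\<otimes>\<^bsub>R\<^esub>) ys \<one>\<^bsub>R\<^esub>" by blast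
      then have "ys \<in> map k ` lists Y" by (auto simp flip: lists_image)
      then obtain xs where xs: "set xs \<subseteq> Y" "ys = map k xs" by auto
      then have "length xs \<le> n" using ys by simp
      then show "z \<in> k ` ?L" unfolding ys(3) xs(2) word[OF xs(1), symmetric] using xs(1) by blast
    qed
  qed
  have L: "?L \<subseteq> carrier A"
    using Y by (auto intro!: A.foldr_mult_closed)
  show ?thesis
    unfolding degree_filtration_def module_hom_span[OF A.module_axioms R.module_axioms k L] img by (rule refl)
qed

section \<open>Filtrations dominated by degree filtrations are tame\<close>

text \<open>
  A basis is mapped to an independent set inside \<open>span G\<close>, so the exchange lemma bounds its size.
  The target may be infinite-dimensional.
\<close>

lemma (in linear_map) inj_dim_le_card:
  assumes fd: "V.fin_dim" and inj: "inj_on T (carrier V)"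
    and G: "finite G" "G \<subseteq> carrier W" and im: "T ` carrier V \<subseteq> W.module.span G"
  shows "V.dim \<le> card G"
proof -
  obtain E where E: "finite E" "V.basis E"
    using V.finite_basis_exists[OF fd] by blast
  then have EV: "E \<subseteq> carrier V" and ind: "V.module.lin_indpt E"
    by (auto simp: V.basis_def)
  have TE: "T ` E \<subseteq> carrier W" using EV by auto
  have ind': "W.module.lin_indpt (T ` E)"
  proof (rule W.module.finite_lin_indpt2)
    fix a assume a: "a \<in> T ` E \<rightarrow> carrier K" and 0: "W.module.lincomb a (T ` E) = \<zero>\<^bsub>W\<^esub>"
    have aT: "a \<circ> T \<in> E \<rightarrow> carrier K" using a by auto
    then have cl: "V.module.lincomb (a \<circ> T) E \<in> carrier V" using EV by auto
    have "T (V.module.lincomb (a \<circ> T) E) = T \<zero>\<^bsub>V\<^esub>"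
      using lincomb_linear_image[OF inj EV a E(1)] 0 f0_is_0 by metis
    then have "V.module.lincomb (a \<circ> T) E = \<zero>\<^bsub>V\<^esub>"
      by (rule inj_onD[OF inj _ cl V.module.M.zero_closed])
    then have "a \<circ> T \<in> E \<rightarrow> {\<zero>\<^bsub>K\<^esub>}"
      by (rule V.not_lindepD[OF ind E(1) subset_refl aT])
    then show "\<forall>v\<in>T ` E. a v = \<zero>\<^bsub>K\<^esub>" by auto
  qed (use E TE in auto)
  have span: "T ` E \<subseteq> W.module.span G" using im EV by blast
  obtain C :: "'e set" where "int (card C) \<le> int (card G) - int (card (T ` E))"
    using W.replacement[OF finite_imageI[OF E(1)] G ind' span] by (elim exE conjE)
  moreover have "card (T ` E) = card E"
    using inj_on_subset[OF inj EV] by (rule card_image)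
  ultimately show ?thesis
    using V.dim_basis[OF E] by linarith
qed

text \<open>
  A word of length at most \<open>n\<close> is a word of length exactly \<open>n\<close> over \<open>X\<close> with one padding letter added.
  The induction counts by first letters.
\<close>

lemma card_lists_length_le_power:
  assumes "finite X"
  shows "card {xs. set xs \<subseteq> X \<and> length xs \<le> n} \<le> Suc (card X) ^ n"
proof (induction n)
  case 0
  have "{xs. set xs \<subseteq> X \<and> length xs \<le> 0} = {[]}" by auto
  then show ?case by simp
next
  case (Suc n)
  let ?L = "\<lambda>n. {xs. set xs \<subseteq> X \<and> length xs \<le> n}"
  have "?L (Suc n) \<subseteq> insert [] (case_prod (#) ` (X \<times> ?L n))"
  proof
    fix xs assume "xs \<in> ?L (Suc n)"
    then show "xs \<in> insert [] (case_prod (#) ` (X \<times> ?L n))" by (cases xs) auto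
  qed
  then have "card (?L (Suc n)) \<le> card (insert [] (case_prod (#) ` (X \<times> ?L n)))"
    using assms by (intro card_mono finite.insertI finite_imageI finite_cartesian_product finite_lists_length_le)
  also have "\<dots> \<le> Suc (card (case_prod (#) ` (X \<times> ?L n)))"
    by (rule card_insert_le_m1) auto
  also have "card (case_prod (#) ` (X \<times> ?L n)) \<le> card (X \<times> ?L n)"
    using assms by (intro card_image_le finite_cartesian_product finite_lists_length_le)
  also have "card (X \<times> ?L n) \<le> card X * Suc (card X) ^ n"
    using Suc by (simp add: card_cartesian_product)
  also have "Suc (card X * Suc (card X) ^ n) \<le> Suc (card X) ^ Suc n" by simp
  finally show ?case by simp
qed

text \<open>
  Stated with a rescaling factor so as to cover both equality (\<open>t = 1\<close>) and equivalence of
  filtrations. An embedding is injective on \<open>\<beta> n\<close>, so the dimension is bounded by the number of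
  words.
\<close>

lemma tame_if_dominated_by_degree_filtration:
  assumes A: "assoc_algebra F A" and B: "assoc_algebra F B" and \<beta>: "filtration F B \<beta>"
    and \<phi>: "alg_embedding F B A \<phi>" and X: "finite X" "X \<subseteq> carrier A"
    and sub: "\<And>n. \<beta> n \<subseteq> restrict_filtration B \<phi> (degree_filtration F A X) (t * n)"
  shows "tame F B \<beta>"
proof -
  interpret A: assoc_algebra F A by fact
  interpret B: assoc_algebra F B by fact
  \<comment> \<open>The dimension is at most \<open>?q ^ n\<close>; tameness asks for a strict inequality, so the constant is \<open>?q + 1\<close>.\<close>
  let ?q = "Suc (card X) ^ t"
  have "vectorspace.dim F (B\<lparr>carrier := \<beta> n\<rparr>) \<le> ?q ^ n" for n
  proof -
    have sp: "subspace F (\<beta> n) B" and fd: "vectorspace.fin_dim F (B\<lparr>carrier := \<beta> n\<rparr>)"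
      using \<beta> by (auto simp: filtration_def)
    interpret V: vectorspace F "B\<lparr>carrier := \<beta> n\<rparr>" using sp by (rule B.subspace_is_vs)
    have le: "\<beta> n \<subseteq> carrier B" using B.subspaceD(1)[OF sp] .
    have hom: "\<phi> \<in> module_hom F (B\<lparr>carrier := \<beta> n\<rparr>) A"
      using \<phi> le by (auto simp: alg_embedding_def module_hom_def subset_iff)
    interpret lm: linear_map F "B\<lparr>carrier := \<beta> n\<rparr>" A \<phi>
      by unfold_locales (rule hom)
    let ?L = "{xs. set xs \<subseteq> X \<and> length xs \<le> t * n}"
    let ?G = "{foldr (\<otimes>\<^bsub>A\<^esub>) xs \<one>\<^bsub>A\<^esub> | xs. set xs \<subseteq> X \<and> length xs \<le> t * n}"
    have G: "?G = (\<lambda>xs. foldr (\<otimes>\<^bsub>A\<^esub>) xs \<one>\<^bsub>A\<^esub>) ` ?L" by auto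
    have fin: "finite ?L" using X(1) by (rule finite_lists_length_le)
    have "V.dim \<le> card ?G"
    proof (rule lm.inj_dim_le_card[OF fd])
      show "inj_on \<phi> (carrier (B\<lparr>carrier := \<beta> n\<rparr>))"
        using \<phi> le by (auto simp: alg_embedding_def intro: inj_on_subset)
      show "finite ?G" unfolding G using fin by (rule finite_imageI)
      show "?G \<subseteq> carrier A" using X(2) by (auto intro!: A.foldr_mult_closed)
      show "\<phi> ` carrier (B\<lparr>carrier := \<beta> n\<rparr>) \<subseteq> A.span ?G"
        using sub[of n] by (auto simp: restrict_filtration_def degree_filtration_def)
    qed
    also have "\<dots> \<le> card ?L" unfolding G using fin by (rule card_image_le)
    also have "\<dots> \<le> Suc (card X) ^ (t * n)" using X(1) by (rule card_lists_length_le_power)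
    finally show ?thesis by (simp add: power_mult)
  qed
  then have "real (vectorspace.dim F (B\<lparr>carrier := \<beta> n\<rparr>)) < real (Suc ?q) ^ n" if "n \<ge> 1" for n
    using that power_strict_mono[of ?q "Suc ?q" n]
    by (metis lessI le_less_trans of_nat_less_iff of_nat_power zero_le not_one_le_zero gr0I)
  then show ?thesis
    unfolding tame_def by (intro exI[of _ "real (Suc ?q)"] conjI of_nat_0_less_iff[THEN iffD2]) auto
qed

section \<open>Countably generated algebras on coordinate functions\<close>

text \<open>
  Choosing for each vector one way of writing it as a linear combination of \<open>W\<close> is injective, since
  the vector can be recovered from its coefficients. The map is not linear in general; the
  structure is going to be transported along it, so injectivity is enough.
\<close>

lemma (in module) span_countable_coordinates:
  assumes W: "countable W" "W \<subseteq> carrier M"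
  shows "\<exists>h :: 'c \<Rightarrow> nat \<Rightarrow> 'a. inj_on h (span W)"
proof -
  let ?supp = "\<lambda>c. {v \<in> W. c v \<noteq> \<zero>\<^bsub>R\<^esub>}"
  have "\<exists>c. c \<in> W \<rightarrow> carrier R \<and> x = lincomb c (?supp c)" if "x \<in> span W" for x
  proof -
    obtain a U where U: "finite U" "U \<subseteq> W" "a \<in> U \<rightarrow> carrier R" "x = lincomb a U"
      using \<open>x \<in> span W\<close> unfolding span_def by blast
    \<comment> \<open>Extension by zero makes the finite set \<open>U\<close> recoverable, up to zero coefficients, from the coefficients alone.\<close>
    define c where "c = (\<lambda>v. if v \<in> U then a v else \<zero>\<^bsub>R\<^esub>)"
    have supp: "?supp c = {v \<in> U. a v \<noteq> \<zero>\<^bsub>R\<^esub>}"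
      using U(2) by (auto simp: c_def)
    have "x = lincomb a {v \<in> U. a v \<noteq> \<zero>\<^bsub>R\<^esub>}"
      unfolding U(4) lincomb_def
      by (rule M.add.finprod_mono_neutral_cong_right)
         (use U W in \<open>auto simp: Pi_iff subset_iff\<close>)
    also have "\<dots> = lincomb c (?supp c)"
      unfolding supp by (rule lincomb_cong) (use U W in \<open>auto simp: c_def\<close>)
    finally show ?thesis
      using U by (intro exI[of _ c]) (auto simp: c_def)
  qed
  then obtain c where c: "\<And>x. x \<in> span W \<Longrightarrow> c x \<in> W \<rightarrow> carrier R"
      "\<And>x. x \<in> span W \<Longrightarrow> x = lincomb (c x) (?supp (c x))"
    by metis
  have "inj_on (\<lambda>x n. c x (from_nat_into W n)) (span W)"
  proof (rule inj_onI)
    fix x y assume x: "x \<in> span W" and y: "y \<in> span W"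
      and eq: "(\<lambda>n. c x (from_nat_into W n)) = (\<lambda>n. c y (from_nat_into W n))"
    have eq': "c x v = c y v" if "v \<in> W" for v
      using fun_cong[OF eq, of "to_nat_on W v"] W(1) that by simp
    then have "?supp (c x) = ?supp (c y)" by auto
    then have "lincomb (c x) (?supp (c x)) = lincomb (c y) (?supp (c y))"
      by (rule lincomb_cong) (use W eq' c(1)[OF y] in auto)
    then show "x = y" using c(2)[OF x] c(2)[OF y] by simp
  qed
  then show ?thesis by blast
qed

text \<open>
  The copy of the subalgebra \<open>S\<close> of \<open>R\<close> that is obtained by renaming its elements along \<open>h\<close>.
\<close>

definition transport_algebra ::
    "('f, 'r, 'k) module_scheme \<Rightarrow> 'r set \<Rightarrow> ('r \<Rightarrow> 'c) \<Rightarrow> ('f, 'c) module" where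
  "transport_algebra R S h = \<lparr>carrier = h ` S,
     mult = (\<lambda>x y. h (inv_into S h x \<otimes>\<^bsub>R\<^esub> inv_into S h y)), one = h \<one>\<^bsub>R\<^esub>,
     zero = h \<zero>\<^bsub>R\<^esub>, add = (\<lambda>x y. h (inv_into S h x \<oplus>\<^bsub>R\<^esub> inv_into S h y)),
     smult = (\<lambda>c x. h (c \<odot>\<^bsub>R\<^esub> inv_into S h x))\<rparr>"

context
  fixes F :: "('f, 'm) ring_scheme" and R :: "('f, 'r, 'k) module_scheme"
    and S :: "'r set" and h :: "'r \<Rightarrow> 'c"
  assumes R: "assoc_algebra F R" and S: "unital_subalgebra F S R" and h: "inj_on h S"
begin

interpretation R: assoc_algebra F R by (rule R)

lemma transport_algebra_simps:
  "carrier (transport_algebra R S h) = h ` S"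
  "\<one>\<^bsub>transport_algebra R S h\<^esub> = h \<one>\<^bsub>R\<^esub>"
  "\<zero>\<^bsub>transport_algebra R S h\<^esub> = h \<zero>\<^bsub>R\<^esub>"
  "\<lbrakk>x \<in> S; y \<in> S\<rbrakk> \<Longrightarrow> h x \<otimes>\<^bsub>transport_algebra R S h\<^esub> h y = h (x \<otimes>\<^bsub>R\<^esub> y)"
  "\<lbrakk>x \<in> S; y \<in> S\<rbrakk> \<Longrightarrow> h x \<oplus>\<^bsub>transport_algebra R S h\<^esub> h y = h (x \<oplus>\<^bsub>R\<^esub> y)"
  "x \<in> S \<Longrightarrow> c \<odot>\<^bsub>transport_algebra R S h\<^esub> h x = h (c \<odot>\<^bsub>R\<^esub> x)"
  using h by (simp_all add: transport_algebra_def)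

lemma transport_algebra_assoc_algebra: "assoc_algebra F (transport_algebra R S h)"
proof -
  let ?A = "transport_algebra R S h"
  note T = transport_algebra_simps
  have sub: "subspace F S R" and 1: "\<one>\<^bsub>R\<^esub> \<in> S"
    and mult: "\<And>x y. x \<in> S \<Longrightarrow> y \<in> S \<Longrightarrow> x \<otimes>\<^bsub>R\<^esub> y \<in> S"
    using S by (auto simp: unital_subalgebra_def)
  note D = R.subspaceD(2-4)[OF sub]
  have C: "x \<in> carrier R" if "x \<in> S" for x using R.subspaceD(1)[OF sub] that by blast
  have "vectorspace F ?A"
  proof (rule vs_criteria)
    show "\<forall>x\<in>carrier ?A. \<exists>y\<in>carrier ?A. x \<oplus>\<^bsub>?A\<^esub> y = \<zero>\<^bsub>?A\<^esub>"
    proof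
      fix x assume "x \<in> carrier ?A"
      then obtain z where z: "z \<in> S" "x = h z" by (auto simp: T)
      then have "(\<ominus>\<^bsub>F\<^esub> \<one>\<^bsub>F\<^esub>) \<odot>\<^bsub>R\<^esub> z \<in> S" by (intro D) auto
      moreover have "z \<oplus>\<^bsub>R\<^esub> ((\<ominus>\<^bsub>F\<^esub> \<one>\<^bsub>F\<^esub>) \<odot>\<^bsub>R\<^esub> z) = \<zero>\<^bsub>R\<^esub>"
        using C[OF z(1)] by (simp add: R.smult_minus_1 R.r_neg)
      ultimately show "\<exists>y\<in>carrier ?A. x \<oplus>\<^bsub>?A\<^esub> y = \<zero>\<^bsub>?A\<^esub>"
        using z by (intro bexI[of _ "h ((\<ominus>\<^bsub>F\<^esub> \<one>\<^bsub>F\<^esub>) \<odot>\<^bsub>R\<^esub> z)"]) (auto simp: T)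
    qed
  qed (auto simp: T D C R.a_ac R.smult_assoc1 R.smult_l_distr R.smult_r_distr R.field_axioms)
  then interpret A: vectorspace F ?A .
  have "ring ?A"
  proof (rule ringI)
    show "abelian_group ?A" by (rule A.abelian_group_axioms)
    show "Group.monoid ?A"
      by (rule monoidI) (auto simp: T mult 1 C R.m_assoc)
  qed (auto simp: T D mult C R.l_distr R.r_distr)
  then interpret A: ring ?A .
  show ?thesis
    by unfold_locales (auto simp: T D mult C R.smult_mult_left R.smult_mult_right)
qed

lemma inv_into_transport_algebra:
  shows "inv_into S h \<in> module_hom F (transport_algebra R S h) R"
    and "inv_into S h \<one>\<^bsub>transport_algebra R S h\<^esub> = \<one>\<^bsub>R\<^esub>"
    and "\<lbrakk>x \<in> carrier (transport_algebra R S h); y \<in> carrier (transport_algebra R S h)\<rbrakk> \<Longrightarrow>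
      inv_into S h (x \<otimes>\<^bsub>transport_algebra R S h\<^esub> y) = inv_into S h x \<otimes>\<^bsub>R\<^esub> inv_into S h y"
proof -
  have sub: "subspace F S R" and 1: "\<one>\<^bsub>R\<^esub> \<in> S"
    and mult: "\<And>x y. x \<in> S \<Longrightarrow> y \<in> S \<Longrightarrow> x \<otimes>\<^bsub>R\<^esub> y \<in> S"
    using S by (auto simp: unital_subalgebra_def)
  note D = R.subspaceD(2-4)[OF sub] and T = transport_algebra_simps
  have C: "x \<in> carrier R" if "x \<in> S" for x using R.subspaceD(1)[OF sub] that by blast
  show "inv_into S h \<in> module_hom F (transport_algebra R S h) R"
    using h by (auto simp: module_hom_def T D C)
  show "inv_into S h \<one>\<^bsub>transport_algebra R S h\<^esub> = \<one>\<^bsub>R\<^esub>"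
    using h 1 by (simp add: T)
  show "\<lbrakk>x \<in> carrier (transport_algebra R S h); y \<in> carrier (transport_algebra R S h)\<rbrakk> \<Longrightarrow>
      inv_into S h (x \<otimes>\<^bsub>transport_algebra R S h\<^esub> y) = inv_into S h x \<otimes>\<^bsub>R\<^esub> inv_into S h y"
    using h by (auto simp: T mult)
qed

lemma transport_algebra_degree_filtration:
  assumes "X \<subseteq> S"
  shows "inv_into S h ` degree_filtration F (transport_algebra R S h) (h ` X) n
      = degree_filtration F R X n"
proof -
  have "inv_into S h ` h ` X = X"
    using assms h by (force simp: image_image)
  moreover have "h ` X \<subseteq> carrier (transport_algebra R S h)"
    using assms by (auto simp: transport_algebra_simps)
  ultimately show ?thesis
    using alg_hom_degree_filtration[OF transport_algebra_assoc_algebra R inv_into_transport_algebra]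
    by metis
qed

lemma transport_algebra_mem_degree_filtration:
  assumes "X \<subseteq> S" "x \<in> S"
  shows "h x \<in> degree_filtration F (transport_algebra R S h) (h ` X) n
      \<longleftrightarrow> x \<in> degree_filtration F R X n"
proof -
  interpret A: assoc_algebra F "transport_algebra R S h" by (rule transport_algebra_assoc_algebra)
  let ?D = "degree_filtration F (transport_algebra R S h) (h ` X) n"
  have "?D \<subseteq> h ` S"
    using A.subspaceD(1)[OF A.degree_filtration_subspace, of "h ` X" n] image_mono[OF assms(1), of h]
    unfolding transport_algebra_simps by blast
  then have "h x \<in> ?D \<longleftrightarrow> inv_into S h (h x) \<in> inv_into S h ` ?D"
    using inj_on_inv_into[of "h ` S" h S] assms(2)
    by (metis imageI inj_on_image_mem_iff order_refl)
  then show ?thesis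
    using transport_algebra_degree_filtration[OF assms(1)] h assms(2) by simp
qed

lemma transport_algebra_embedding:
  assumes "alg_embedding F B R \<phi>" "\<phi> ` carrier B \<subseteq> S"
  shows "alg_embedding F B (transport_algebra R S h) (h \<circ> \<phi>)"
  using assms h
  by (auto simp: alg_embedding_def module_hom_def transport_algebra_simps image_subset_iff inj_on_def)

end

text \<open>
  The subalgebra generated by a countable set is spanned by countably many words, so it has a copy
  whose elements are functions \<open>nat \<Rightarrow> 'f\<close>, with the same traces of its degree filtration on \<open>B\<close>.
\<close>

lemma (in assoc_algebra) countable_realization:
  assumes X: "countable X" "X \<subseteq> carrier A"
    and \<phi>: "alg_embedding F B A \<phi>" "\<phi> ` carrier B \<subseteq> (\<Union>n. degree_filtration F A X n)"
  shows "\<exists>(A' :: ('f, nat \<Rightarrow> 'f) module) \<psi> h. assoc_algebra F A' \<and> alg_embedding F B A' \<psi> \<and>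
    alg_generated_by F A' (h ` X) \<and>
    restrict_filtration B \<psi> (degree_filtration F A' (h ` X))
      = restrict_filtration B \<phi> (degree_filtration F A X)"
proof -
  let ?S = "\<Union>n. degree_filtration F A X n"
  let ?W = "(\<lambda>xs. foldr (\<otimes>\<^bsub>A\<^esub>) xs \<one>\<^bsub>A\<^esub>) ` lists X"
  have S: "unital_subalgebra F ?S A"
    using X(2) by (rule Union_degree_filtration_subalgebra)
  have "?W \<subseteq> carrier A"
    using X(2) by (auto intro!: foldr_mult_closed)
  then obtain h :: "'a \<Rightarrow> nat \<Rightarrow> 'f" where "inj_on h (span ?W)"
    using span_countable_coordinates[of ?W] X(1) by auto
  moreover have "?S \<subseteq> span ?W"
    unfolding degree_filtration_def by (intro UN_least span_is_monotone) auto
  ultimately have h: "inj_on h ?S" by (rule inj_on_subset)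
  let ?A = "transport_algebra A ?S h"
  have XS: "X \<subseteq> ?S"
  proof
    fix x assume "x \<in> X"
    then have "x \<in> degree_filtration F A X 1"
      using word_in_degree_filtration[OF X(2), of "[x]" 1] X(2) by auto
    then show "x \<in> ?S" by blast
  qed
  note mem = transport_algebra_mem_degree_filtration[OF assoc_algebra_axioms S h XS]
  interpret A': assoc_algebra F ?A
    using assoc_algebra_axioms S h by (rule transport_algebra_assoc_algebra)
  have carr: "carrier ?A = h ` ?S"
    using assoc_algebra_axioms S h by (rule transport_algebra_simps)
  have hX: "h ` X \<subseteq> carrier ?A" using XS by (auto simp: carr)
  have "carrier ?A \<subseteq> (\<Union>n. degree_filtration F ?A (h ` X) n)"
    unfolding carr using mem by blast
  moreover have "degree_filtration F ?A (h ` X) n \<subseteq> carrier ?A" for n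
    using A'.subspaceD(1)[OF A'.degree_filtration_subspace[OF hX]] .
  ultimately have "alg_generated_by F ?A (h ` X)"
    by (intro A'.alg_generated_byI hX) blast
  moreover have "restrict_filtration B (h \<circ> \<phi>) (degree_filtration F ?A (h ` X))
      = restrict_filtration B \<phi> (degree_filtration F A X)"
    unfolding restrict_filtration_def using \<phi>(2) mem by (intro ext Collect_cong) auto
  moreover have "alg_embedding F B ?A (h \<circ> \<phi>)"
    using assoc_algebra_axioms S h \<phi> by (rule transport_algebra_embedding)
  ultimately show ?thesis
    using A'.assoc_algebra_axioms by blast
qed

section \<open>Function spaces and algebras of linear operators\<close>

definition fun_space :: "('f, 'm, 'n) module_scheme \<Rightarrow> ('f, 'u \<Rightarrow> 'm) module" where
  "fun_space M = \<lparr>carrier = {f. \<forall>u. f u \<in> carrier M},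
     mult = (\<lambda>f g u. \<zero>\<^bsub>M\<^esub>), one = (\<lambda>u. \<zero>\<^bsub>M\<^esub>),
     zero = (\<lambda>u. \<zero>\<^bsub>M\<^esub>), add = (\<lambda>f g u. f u \<oplus>\<^bsub>M\<^esub> g u), smult = (\<lambda>c f u. c \<odot>\<^bsub>M\<^esub> f u)\<rparr>"

lemma fun_space_simps [simp]:
  "f \<in> carrier (fun_space M) \<longleftrightarrow> (\<forall>u. f u \<in> carrier M)"
  "\<zero>\<^bsub>fun_space M\<^esub> = (\<lambda>u. \<zero>\<^bsub>M\<^esub>)"
  "f \<oplus>\<^bsub>fun_space M\<^esub> g = (\<lambda>u. f u \<oplus>\<^bsub>M\<^esub> g u)"
  "c \<odot>\<^bsub>fun_space M\<^esub> f = (\<lambda>u. c \<odot>\<^bsub>M\<^esub> f u)"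
  by (simp_all add: fun_space_def)

lemma fun_space_vectorspace:
  assumes "vectorspace K M"
  shows "vectorspace K (fun_space M :: ('f, 'u \<Rightarrow> 'm) module)"
proof -
  interpret M: vectorspace K M by fact
  show ?thesis
  proof (rule vs_criteria)
    show "\<forall>v\<in>carrier (fun_space M :: ('f, 'u \<Rightarrow> 'm) module). \<exists>neg_v\<in>carrier (fun_space M). v \<oplus>\<^bsub>fun_space M\<^esub> neg_v = \<zero>\<^bsub>fun_space M\<^esub>"
    proof
      fix f :: "'u \<Rightarrow> 'm" assume "f \<in> carrier (fun_space M)"
      then show "\<exists>g\<in>carrier (fun_space M). f \<oplus>\<^bsub>fun_space M\<^esub> g = \<zero>\<^bsub>fun_space M\<^esub>"
        by (intro bexI[of _ "\<lambda>u. \<ominus>\<^bsub>M\<^esub> f u"]) (auto simp: M.r_neg)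
    qed
  qed (auto simp: M.a_ac M.smult_assoc1 M.smult_l_distr M.smult_r_distr M.field_axioms)
qed

text \<open>
  Operators are taken extensional, so that those agreeing on \<open>V\<close> are equal and the algebra axioms hold
  literally.
\<close>

definition linear_endos :: "('f, 'm) ring_scheme \<Rightarrow> ('f, 'v, 'n) module_scheme \<Rightarrow> ('f, 'v \<Rightarrow> 'v) module" where
  "linear_endos F V = \<lparr>carrier = {T \<in> module_hom F V V. T \<in> extensional (carrier V)},
     mult = compose (carrier V), one = (\<lambda>v\<in>carrier V. v),
     zero = (\<lambda>v\<in>carrier V. \<zero>\<^bsub>V\<^esub>), add = (\<lambda>S T. \<lambda>v\<in>carrier V. S v \<oplus>\<^bsub>V\<^esub> T v),
     smult = (\<lambda>c T. \<lambda>v\<in>carrier V. c \<odot>\<^bsub>V\<^esub> T v)\<rparr>"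

lemma linear_endos_simps [simp]:
  "\<one>\<^bsub>linear_endos F V\<^esub> = (\<lambda>v\<in>carrier V. v)"
  "\<zero>\<^bsub>linear_endos F V\<^esub> = (\<lambda>v\<in>carrier V. \<zero>\<^bsub>V\<^esub>)"
  "S \<otimes>\<^bsub>linear_endos F V\<^esub> T = compose (carrier V) S T"
  "S \<oplus>\<^bsub>linear_endos F V\<^esub> T = (\<lambda>v\<in>carrier V. S v \<oplus>\<^bsub>V\<^esub> T v)"
  "c \<odot>\<^bsub>linear_endos F V\<^esub> T = (\<lambda>v\<in>carrier V. c \<odot>\<^bsub>V\<^esub> T v)"
  by (simp_all add: linear_endos_def)

lemma linear_endos_carrier:
  "T \<in> carrier (linear_endos F V) \<longleftrightarrow>
    T \<in> extensional (carrier V) \<and> (\<forall>v\<in>carrier V. T v \<in> carrier V) \<and>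
    (\<forall>v\<in>carrier V. \<forall>w\<in>carrier V. T (v \<oplus>\<^bsub>V\<^esub> w) = T v \<oplus>\<^bsub>V\<^esub> T w) \<and>
    (\<forall>c\<in>carrier F. \<forall>v\<in>carrier V. T (c \<odot>\<^bsub>V\<^esub> v) = c \<odot>\<^bsub>V\<^esub> T v)"
  by (auto simp: linear_endos_def module_hom_def)

lemma linear_endos_assoc_algebra:
  fixes V :: "('f, 'v, 'n) module_scheme"
  assumes "vectorspace F V"
  shows "assoc_algebra F (linear_endos F V)"
proof -
  interpret V: vectorspace F V by fact
  let ?E = "linear_endos F V"
  have eqI: "S = T" if "S \<in> extensional (carrier V)" "T \<in> extensional (carrier V)"
    "\<And>v. v \<in> carrier V \<Longrightarrow> S v = T v" for S T :: "'v \<Rightarrow> 'v"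
    using that by (rule extensionalityI)
  note C = linear_endos_carrier
  have add: "S \<oplus>\<^bsub>?E\<^esub> T \<in> carrier ?E" if "S \<in> carrier ?E" "T \<in> carrier ?E" for S T
    using that by (auto simp: C V.a_ac V.smult_r_distr)
  have smult: "c \<odot>\<^bsub>?E\<^esub> T \<in> carrier ?E" if "c \<in> carrier F" "T \<in> carrier ?E" for c T
    using that by (auto simp: C V.smult_r_distr V.R.m_comm simp flip: V.smult_assoc1)
  have mult: "S \<otimes>\<^bsub>?E\<^esub> T \<in> carrier ?E" if "S \<in> carrier ?E" "T \<in> carrier ?E" for S T
    using that by (auto simp: C compose_def)
  have zero: "\<zero>\<^bsub>?E\<^esub> \<in> carrier ?E" and one: "\<one>\<^bsub>?E\<^esub> \<in> carrier ?E"
    by (auto simp: C)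
  have vs: "vectorspace F ?E"
  proof (rule vs_criteria)
    show "\<forall>T\<in>carrier ?E. \<exists>S\<in>carrier ?E. T \<oplus>\<^bsub>?E\<^esub> S = \<zero>\<^bsub>?E\<^esub>"
    proof
      fix T assume T: "T \<in> carrier ?E"
      have "(\<ominus>\<^bsub>F\<^esub> \<one>\<^bsub>F\<^esub>) \<odot>\<^bsub>?E\<^esub> T \<in> carrier ?E" using T by (intro smult) auto
      moreover have "T \<oplus>\<^bsub>?E\<^esub> ((\<ominus>\<^bsub>F\<^esub> \<one>\<^bsub>F\<^esub>) \<odot>\<^bsub>?E\<^esub> T) = \<zero>\<^bsub>?E\<^esub>"
        using T by (auto intro!: eqI simp: C V.smult_minus_1 V.r_neg)
      ultimately show "\<exists>S\<in>carrier ?E. T \<oplus>\<^bsub>?E\<^esub> S = \<zero>\<^bsub>?E\<^esub>" by blast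
    qed
    show "\<forall>v w. v \<in> carrier ?E \<and> w \<in> carrier ?E \<longrightarrow> v \<oplus>\<^bsub>?E\<^esub> w \<in> carrier ?E"
      using add by blast
    show "\<forall>c v. c \<in> carrier F \<and> v \<in> carrier ?E \<longrightarrow> c \<odot>\<^bsub>?E\<^esub> v \<in> carrier ?E"
      using smult by blast
  qed (use zero in \<open>auto intro!: eqI simp: C V.a_ac V.smult_assoc1 V.smult_l_distr V.smult_r_distr V.field_axioms\<close>)
  then interpret E: vectorspace F ?E .
  have "ring ?E"
  proof (rule ringI)
    show "abelian_group ?E" by (rule E.abelian_group_axioms)
    show "Group.monoid ?E"
      by (rule monoidI)
         (use mult one in \<open>auto intro!: eqI simp: C compose_def\<close>)
  qed (auto intro!: eqI simp: C compose_def)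
  then interpret R: ring ?E .
  show ?thesis
    by unfold_locales (auto intro!: eqI simp: C compose_def)
qed

section \<open>Overlap-free codes and the operators of their letters\<close>

text \<open>
  The condition \<open>overlap_free\<close> says that a codeword read off a stack whose top part is a nonempty
  suffix of a codeword can only be that codeword itself. With \<open>p = []\<close> this makes the code
  prefix-free; with \<open>p \<noteq> []\<close> it excludes that a proper suffix of a codeword begins
  with a codeword, or is completed to one by the rest of the stack.
\<close>

locale overlap_free_code =
  fixes I :: "'i set" and w :: "'i \<Rightarrow> 'x list"
  assumes nonempty: "i \<in> I \<Longrightarrow> w i \<noteq> []"
    and overlap_free:
      "\<lbrakk>i \<in> I; j \<in> I; w i = p @ s; s \<noteq> []; s @ u = w j @ v\<rbrakk> \<Longrightarrow> p = [] \<and> i = j"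
begin

definition decode :: "'x list \<Rightarrow> ('i \<times> 'x list) option" where
  "decode u = (if \<exists>i v. i \<in> I \<and> u = w i @ v
     then Some (SOME (i, v). i \<in> I \<and> u = w i @ v) else None)"

lemma decode_SomeD:
  assumes "decode u = Some (i, v)"
  shows "i \<in> I" "u = w i @ v"
proof -
  have ex: "\<exists>i v. i \<in> I \<and> u = w i @ v" and eq: "(i, v) = (SOME (i, v). i \<in> I \<and> u = w i @ v)"
    using assms by (auto simp: decode_def split: if_splits)
  have "case (SOME (i, v). i \<in> I \<and> u = w i @ v) of (i, v) \<Rightarrow> i \<in> I \<and> u = w i @ v"
    by (rule someI_ex) (use ex in auto)
  then show "i \<in> I" "u = w i @ v" by (simp_all flip: eq)
qed

lemma decode_codeword:
  assumes "i \<in> I"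
  shows "decode (w i @ v) = Some (i, v)"
proof -
  have "decode (w i @ v) \<noteq> None" using assms by (auto simp: decode_def)
  then obtain j v' where j: "decode (w i @ v) = Some (j, v')" by auto
  then have "i = j" "w i @ v = w j @ v'"
    using decode_SomeD[OF j] overlap_free[OF assms, of j "[]" "w i" v v'] nonempty[OF assms] by auto
  then show ?thesis using j by simp
qed

text \<open>
  While the letters of a codeword are pushed one by one, no reduction is triggered prematurely,
  whatever lies below them on the stack.
\<close>

lemma decode_proper_suffix:
  assumes "i \<in> I" "w i = p @ s" "p \<noteq> []" "s \<noteq> []"
  shows "decode (s @ u) = None"
proof (rule ccontr)
  assume "decode (s @ u) \<noteq> None"
  then obtain j v where j: "decode (s @ u) = Some (j, v)" by auto
  show False
    using overlap_free[OF assms(1) decode_SomeD(1)[OF j] assms(2,4) decode_SomeD(2)[OF j]] assms(3) by simp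
qed

end

text \<open>
  A left module without unit axiom: letting the unit of \<open>B\<close> act as any idempotent permits embeddings
  of \<open>B\<close> that do not preserve the unit.
\<close>

locale left_module = B: assoc_algebra F B + M: vectorspace F M
  for F :: "('f, 'k) ring_scheme" and B :: "('f, 'b, 'n) module_scheme"
    and M :: "('f, 'm, 'l) module_scheme" +
  fixes act :: "'b \<Rightarrow> 'm \<Rightarrow> 'm"
  assumes act_closed: "\<lbrakk>b \<in> carrier B; m \<in> carrier M\<rbrakk> \<Longrightarrow> act b m \<in> carrier M"
    and act_add_right: "\<lbrakk>b \<in> carrier B; m \<in> carrier M; m' \<in> carrier M\<rbrakk> \<Longrightarrow>
      act b (m \<oplus>\<^bsub>M\<^esub> m') = act b m \<oplus>\<^bsub>M\<^esub> act b m'"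
    and act_smult_right: "\<lbrakk>b \<in> carrier B; c \<in> carrier F; m \<in> carrier M\<rbrakk> \<Longrightarrow>
      act b (c \<odot>\<^bsub>M\<^esub> m) = c \<odot>\<^bsub>M\<^esub> act b m"
    and act_add_left: "\<lbrakk>b \<in> carrier B; b' \<in> carrier B; m \<in> carrier M\<rbrakk> \<Longrightarrow>
      act (b \<oplus>\<^bsub>B\<^esub> b') m = act b m \<oplus>\<^bsub>M\<^esub> act b' m"
    and act_smult_left: "\<lbrakk>c \<in> carrier F; b \<in> carrier B; m \<in> carrier M\<rbrakk> \<Longrightarrow>
      act (c \<odot>\<^bsub>B\<^esub> b) m = c \<odot>\<^bsub>M\<^esub> act b m"
    and act_mult: "\<lbrakk>b \<in> carrier B; b' \<in> carrier B; m \<in> carrier M\<rbrakk> \<Longrightarrow>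
      act (b \<otimes>\<^bsub>B\<^esub> b') m = act b (act b' m)"

locale stack_machine = overlap_free_code I w + left_module F B M act
  for I :: "'i set" and w :: "'i \<Rightarrow> 'x list"
    and F :: "('f, 'k) ring_scheme" and B :: "('f, 'b, 'n) module_scheme"
    and M :: "('f, 'm, 'l) module_scheme" and act +
  fixes g :: "'i \<Rightarrow> 'b"
  assumes g_closed: "i \<in> I \<Longrightarrow> g i \<in> carrier B"
begin

abbreviation V :: "('f, 'x list \<Rightarrow> 'm) module" where "V \<equiv> fun_space M"
abbreviation E where "E \<equiv> linear_endos F V"

definition letter_op :: "'x \<Rightarrow> ('x list \<Rightarrow> 'm) \<Rightarrow> 'x list \<Rightarrow> 'm" where
  "letter_op a = (\<lambda>f\<in>carrier V. \<lambda>u. case decode (a # u) of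
     None \<Rightarrow> f (a # u) | Some (i, v) \<Rightarrow> act (g i) (f v))"

definition left_mult :: "'b \<Rightarrow> ('x list \<Rightarrow> 'm) \<Rightarrow> 'x list \<Rightarrow> 'm" where
  "left_mult b = (\<lambda>f\<in>carrier V. \<lambda>u. act b (f u))"

sublocale E: assoc_algebra F E
  by (intro linear_endos_assoc_algebra fun_space_vectorspace M.vectorspace_axioms)

lemma letter_op_closed: "letter_op a \<in> carrier E"
  by (auto simp: linear_endos_carrier letter_op_def act_closed act_add_right act_smult_right g_closed
      fun_eq_iff dest: decode_SomeD split: option.split)

lemma letter_op_apply_closed: "f \<in> carrier V \<Longrightarrow> letter_op a f \<in> carrier V"
  using letter_op_closed[of a] unfolding linear_endos_carrier by blast

lemma left_mult_closed: "b \<in> carrier B \<Longrightarrow> left_mult b \<in> carrier E"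
  by (auto simp: linear_endos_carrier left_mult_def act_closed act_add_right act_smult_right)

text \<open>
  The operator applied last is the outermost one and determines the letter pushed first, that is, the
  bottom one. Words are therefore reversed when a codeword is turned into a product of operators.
\<close>

lemma word_op_proper_suffix:
  assumes "i \<in> I" "w i = p @ s" "p \<noteq> []" "f \<in> carrier V"
  shows "foldr (\<otimes>\<^bsub>E\<^esub>) (map letter_op (rev s)) \<one>\<^bsub>E\<^esub> f u = f (s @ u)"
  using assms
proof (induction s arbitrary: p f)
  case (Cons a s)
  let ?P = "foldr (\<otimes>\<^bsub>E\<^esub>) (map letter_op (rev s)) \<one>\<^bsub>E\<^esub>"
  have "foldr (\<otimes>\<^bsub>E\<^esub>) (map letter_op (rev (a # s))) \<one>\<^bsub>E\<^esub> = ?P \<otimes>\<^bsub>E\<^esub> letter_op a"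
    using E.foldr_mult_append[of "map letter_op (rev s)" "[letter_op a]"] letter_op_closed
      E.r_one[OF letter_op_closed] by (auto simp del: linear_endos_simps)
  then have "foldr (\<otimes>\<^bsub>E\<^esub>) (map letter_op (rev (a # s))) \<one>\<^bsub>E\<^esub> f u = ?P (letter_op a f) u"
    using Cons.prems by (simp add: compose_def)
  also have "\<dots> = letter_op a f (s @ u)"
    using Cons.prems by (intro Cons.IH[of "p @ [a]"] letter_op_apply_closed) auto
  also have "\<dots> = f (a # s @ u)"
    using decode_proper_suffix[OF Cons.prems(1-3), of u] Cons.prems(4) by (simp add: letter_op_def)
  finally show ?case unfolding append_Cons .
qed simp

text \<open>
  All letters of the codeword but its first one just pile up on the stack; the first one completes
  the codeword, which is then replaced by the action of \<open>g i\<close>.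
\<close>

lemma codeword_op:
  assumes i: "i \<in> I"
  shows "foldr (\<otimes>\<^bsub>E\<^esub>) (map letter_op (rev (w i))) \<one>\<^bsub>E\<^esub> = left_mult (g i)"
proof -
  obtain a s where as: "w i = a # s" using nonempty[OF i] by (cases "w i") auto
  let ?P = "foldr (\<otimes>\<^bsub>E\<^esub>) (map letter_op (rev s)) \<one>\<^bsub>E\<^esub>"
  have P: "foldr (\<otimes>\<^bsub>E\<^esub>) (map letter_op (rev (w i))) \<one>\<^bsub>E\<^esub> = ?P \<otimes>\<^bsub>E\<^esub> letter_op a"
    using E.foldr_mult_append[of "map letter_op (rev s)" "[letter_op a]"] letter_op_closed
      E.r_one[OF letter_op_closed] by (auto simp: as simp del: linear_endos_simps)
  show ?thesis
  proof (rule extensionalityI[of _ "carrier V"])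
    show "foldr (\<otimes>\<^bsub>E\<^esub>) (map letter_op (rev (w i))) \<one>\<^bsub>E\<^esub> \<in> extensional (carrier V)"
      unfolding P by (simp add: compose_def)
    show "left_mult (g i) \<in> extensional (carrier V)" by (simp add: left_mult_def)
    fix f assume f: "f \<in> carrier V"
    have "?P (letter_op a f) u = act (g i) (f u)" for u
    proof -
      have "?P (letter_op a f) u = letter_op a f (s @ u)"
        using as f by (intro word_op_proper_suffix[OF i, of "[a]"] letter_op_apply_closed) auto
      also have "\<dots> = act (g i) (f u)"
        using decode_codeword[OF i, of u] as f by (simp add: letter_op_def)
      finally show ?thesis .
    qed
    then show "foldr (\<otimes>\<^bsub>E\<^esub>) (map letter_op (rev (w i))) \<one>\<^bsub>E\<^esub> f = left_mult (g i) f"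
      unfolding P using f by (auto simp: compose_def left_mult_def)
  qed
qed

lemma codeword_op_degree:
  assumes "i \<in> I" "set (w i) \<subseteq> L" "length (w i) \<le> n"
  shows "left_mult (g i) \<in> degree_filtration F E (letter_op ` L) n"
  unfolding codeword_op[OF assms(1), symmetric]
  using assms(2,3) by (intro E.word_in_degree_filtration) (auto intro: letter_op_closed)

lemma left_mult_hom: "left_mult \<in> module_hom F B E"
  by (auto simp: module_hom_def left_mult_closed)
     (auto simp: left_mult_def act_add_left act_smult_left fun_eq_iff act_closed)

lemma left_mult_mult:
  "\<lbrakk>b \<in> carrier B; b' \<in> carrier B\<rbrakk> \<Longrightarrow> left_mult (b \<otimes>\<^bsub>B\<^esub> b') = left_mult b \<otimes>\<^bsub>E\<^esub> left_mult b'"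
  by (auto simp: left_mult_def act_mult fun_eq_iff compose_def act_closed)

lemma left_mult_embedding:
  assumes m: "m \<in> carrier M" and inj: "inj_on (\<lambda>b. act b m) (carrier B)"
  shows "alg_embedding F B E left_mult"
proof -
  have "left_mult b (\<lambda>u. m) u = act b m" for b u
    using m by (simp add: left_mult_def)
  then have "inj_on left_mult (carrier B)"
    using inj by (metis inj_on_def)
  then show ?thesis
    unfolding alg_embedding_def using left_mult_hom left_mult_mult by blast
qed

end

section \<open>The weight bound\<close>

context stack_machine
begin

text \<open>
  Pushing a letter lengthens the stack by one. Erasing a codeword \<open>w i\<close> turns the stack \<open>u\<close> into one
  that is shorter by \<open>|w i| - 1\<close>, while acting with \<open>g i\<close> costs at most \<open>|w i|\<close> degrees. So either way
  one operator costs one degree, and \<open>n\<close> of them cost \<open>n\<close>.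
\<close>

lemma degree_raises_weight:
  assumes \<mu>: "\<And>n. subspace F (\<mu> n) M" "\<And>n. \<mu> n \<subseteq> \<mu> (Suc n)"
    and g: "\<And>i m n. \<lbrakk>i \<in> I; m \<in> \<mu> n\<rbrakk> \<Longrightarrow> act (g i) m \<in> \<mu> (length (w i) + n)"
    and f: "\<And>u. f u \<in> \<mu> (length u)"
    and T: "T \<in> degree_filtration F E (letter_op ` L) n"
  shows "T f u \<in> \<mu> (n + length u)"
proof -
  have \<mu>M: "\<mu> n \<subseteq> carrier M" and \<mu>0: "\<zero>\<^bsub>M\<^esub> \<in> \<mu> n"
    and \<mu>add: "\<And>x y. x \<in> \<mu> n \<Longrightarrow> y \<in> \<mu> n \<Longrightarrow> x \<oplus>\<^bsub>M\<^esub> y \<in> \<mu> n"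
    and \<mu>smult: "\<And>c x. c \<in> carrier F \<Longrightarrow> x \<in> \<mu> n \<Longrightarrow> c \<odot>\<^bsub>M\<^esub> x \<in> \<mu> n" for n
    using \<mu>(1)[of n] by (auto simp: subspace_def submodule_def)
  have mono: "\<mu> m \<subseteq> \<mu> n" if "m \<le> n" for m n
    using \<mu>(2) that by (rule lift_Suc_mono_le)
  have inV: "h \<in> carrier V" if "\<And>u. h u \<in> \<mu> (j + length u)" for h j
    using that \<mu>M by (auto simp: subset_iff)
  have letter: "letter_op a h u \<in> \<mu> (Suc j + length u)"
    if h: "\<And>u. h u \<in> \<mu> (j + length u)" for a h j u
  proof (cases "decode (a # u)")
    case None
    then show ?thesis using h[of "a # u"] inV[OF h] by (simp add: letter_op_def)
  next
    case (Some iv)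
    then obtain i v where iv: "decode (a # u) = Some (i, v)" by (cases iv) auto
    have "length (w i) + (j + length v) = Suc j + length u"
      using arg_cong[OF decode_SomeD(2)[OF iv], of length] by simp
    then have "act (g i) (h v) \<in> \<mu> (Suc j + length u)"
      using g[OF decode_SomeD(1)[OF iv] h[of v]] by metis
    then show ?thesis
      using iv inV[OF h] by (simp add: letter_op_def)
  qed
  have word: "foldr (\<otimes>\<^bsub>E\<^esub>) xs \<one>\<^bsub>E\<^esub> f u \<in> \<mu> (length xs + length u)"
    if "set xs \<subseteq> letter_op ` L" for xs u
    using that
  proof (induction xs arbitrary: u)
    case Nil
    have "f \<in> carrier V" using inV[of f 0] f by simp
    then show ?case using f by simp
  next
    case (Cons x xs)
    then obtain a where a: "x = letter_op a" by auto
    have "f \<in> carrier V" using inV[of f 0] f by simp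
    then have "foldr (\<otimes>\<^bsub>E\<^esub>) (x # xs) \<one>\<^bsub>E\<^esub> f = letter_op a (foldr (\<otimes>\<^bsub>E\<^esub>) xs \<one>\<^bsub>E\<^esub> f)"
      unfolding foldr.simps comp_apply linear_endos_simps(3) a compose_def by (rule restrict_apply')
    moreover have "letter_op a (foldr (\<otimes>\<^bsub>E\<^esub>) xs \<one>\<^bsub>E\<^esub> f) u \<in> \<mu> (Suc (length xs) + length u)"
      by (intro letter Cons.IH) (use Cons.prems in auto)
    ultimately show ?case by (simp only: list.size(4) add_Suc_right add_0_right)
  qed
  let ?N = "{T \<in> carrier E. \<forall>u. T f u \<in> \<mu> (n + length u)}"
  have fV: "f \<in> carrier V" using inV[of f 0] f by simp
  have X: "letter_op ` L \<subseteq> carrier E" using letter_op_closed by blast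
  have "degree_filtration F E (letter_op ` L) n \<subseteq> ?N"
  proof (rule E.degree_filtration_least)
    show "subspace F ?N E"
    proof (rule E.subspaceI)
      show "?N \<subseteq> carrier E" by blast
      show "\<zero>\<^bsub>E\<^esub> \<in> ?N" using E.zero_closed fV \<mu>0 by simp
      show "S \<oplus>\<^bsub>E\<^esub> T \<in> ?N" if "S \<in> ?N" "T \<in> ?N" for S T
        using that E.a_closed[of S T] fV \<mu>add by simp
      show "c \<odot>\<^bsub>E\<^esub> T \<in> ?N" if "c \<in> carrier F" "T \<in> ?N" for c T
        using that E.smult_closed[of c T] fV \<mu>smult by simp
    qed
    fix xs assume xs: "set xs \<subseteq> letter_op ` L" "length xs \<le> n"
    have "foldr (\<otimes>\<^bsub>E\<^esub>) xs \<one>\<^bsub>E\<^esub> \<in> carrier E"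
      using E.foldr_mult_closed[OF subset_trans[OF xs(1) X]] .
    moreover have "foldr (\<otimes>\<^bsub>E\<^esub>) xs \<one>\<^bsub>E\<^esub> f u \<in> \<mu> (n + length u)" for u
      using word[OF xs(1), of u] mono[of "length xs + length u" "n + length u"] xs(2) by auto
    ultimately show "foldr (\<otimes>\<^bsub>E\<^esub>) xs \<one>\<^bsub>E\<^esub> \<in> ?N" by blast
  qed
  then show ?thesis using T by blast
qed

end

text \<open>
  The vector \<open>m\<close> of weight \<open>0\<close> detects \<open>B\<close> together with its filtration: \<open>b\<close> can be recovered from
  \<open>act b m\<close>, and the degree of \<open>b\<close> is bounded by the weight of \<open>act b m\<close>. The condition \<open>degree_0\<close>
  matches \<open>\<beta> 0\<close> with the scalars, which form degree \<open>0\<close> of every degree filtration.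
\<close>

locale filtered_stack_machine = stack_machine I w F B M act g
  for I :: "'i set" and w :: "'i \<Rightarrow> 'x list"
    and F :: "('f, 'k) ring_scheme" and B :: "('f, 'b, 'n) module_scheme"
    and M :: "('f, 'm, 'l) module_scheme" and act g +
  fixes d :: "'i \<Rightarrow> nat" and t :: nat and \<beta> :: "nat \<Rightarrow> 'b set"
    and \<mu> :: "nat \<Rightarrow> 'm set" and m :: 'm
  assumes \<beta>: "filtration F B \<beta>"
    and g_degree: "i \<in> I \<Longrightarrow> g i \<in> \<beta> (d i)"
    and codeword_length: "i \<in> I \<Longrightarrow> d i \<le> length (w i) \<and> length (w i) \<le> t * d i"
    and g_span: "n \<ge> 1 \<Longrightarrow> \<beta> n \<subseteq> B.span {g i | i. i \<in> I \<and> d i = n}"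
    and degree_0: "b \<in> \<beta> 0 \<Longrightarrow> \<exists>c\<in>carrier F. \<forall>x\<in>carrier M. act b x = c \<odot>\<^bsub>M\<^esub> x"
    and \<mu>_subspace: "subspace F (\<mu> n) M"
    and \<mu>_mono: "\<mu> n \<subseteq> \<mu> (Suc n)"
    and \<mu>_act: "\<lbrakk>b \<in> \<beta> k; x \<in> \<mu> n\<rbrakk> \<Longrightarrow> act b x \<in> \<mu> (k + n)"
    and m_weight: "m \<in> \<mu> 0"
    and m_detects: "\<lbrakk>b \<in> carrier B; act b m \<in> \<mu> n\<rbrakk> \<Longrightarrow> b \<in> \<beta> n"
    and m_faithful: "inj_on (\<lambda>b. act b m) (carrier B)"
begin

lemma \<mu>_mono_le: "k \<le> n \<Longrightarrow> \<mu> k \<subseteq> \<mu> n"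
  using \<mu>_mono by (rule lift_Suc_mono_le)

lemma m_closed: "m \<in> carrier M"
  using \<mu>_subspace[of 0] m_weight by (auto simp: subspace_def submodule_def)

lemma embedding: "alg_embedding F B E left_mult"
  using m_closed m_faithful by (rule left_mult_embedding)

text \<open>
  Evaluate the operator of \<open>b\<close> at the constant function \<open>m\<close>, which has weight \<open>0\<close>, and at the empty
  stack.
\<close>

lemma restriction_subset:
  "restrict_filtration B left_mult (degree_filtration F E (letter_op ` L)) n \<subseteq> \<beta> n"
proof
  fix b assume "b \<in> restrict_filtration B left_mult (degree_filtration F E (letter_op ` L)) n"
  then have b: "b \<in> carrier B" and D: "left_mult b \<in> degree_filtration F E (letter_op ` L) n"
    by (auto simp: restrict_filtration_def)
  have "left_mult b (\<lambda>u. m) [] \<in> \<mu> (n + length ([] :: 'x list))"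
  proof (rule degree_raises_weight[where \<mu> = \<mu>, OF \<mu>_subspace \<mu>_mono _ _ D])
    fix i x n assume "i \<in> I" "x \<in> \<mu> n"
    then show "act (g i) x \<in> \<mu> (length (w i) + n)"
      using \<mu>_act[OF g_degree] codeword_length \<mu>_mono_le[of "d i + n" "length (w i) + n"] by auto
  next
    show "m \<in> \<mu> (length u)" for u :: "'x list"
      using \<mu>_mono_le[of 0 "length u"] m_weight by auto
  qed
  then have "act b m \<in> \<mu> n" using m_closed by (simp add: left_mult_def)
  with b show "b \<in> \<beta> n" by (rule m_detects)
qed

lemma subset_restriction:
  assumes L: "\<And>i. i \<in> I \<Longrightarrow> set (w i) \<subseteq> L"
  shows "\<beta> n \<subseteq> restrict_filtration B left_mult (degree_filtration F E (letter_op ` L)) (t * n)"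
proof -
  let ?X = "letter_op ` L"
  have X: "?X \<subseteq> carrier E" using letter_op_closed by blast
  note D = E.subspaceD[OF E.degree_filtration_subspace[OF X]]
  let ?R = "restrict_filtration B left_mult (degree_filtration F E ?X) (t * n)"
  have hom: "left_mult (x \<oplus>\<^bsub>B\<^esub> y) = left_mult x \<oplus>\<^bsub>E\<^esub> left_mult y"
      "c \<in> carrier F \<Longrightarrow> left_mult (c \<odot>\<^bsub>B\<^esub> x) = c \<odot>\<^bsub>E\<^esub> left_mult x"
    if "x \<in> carrier B" "y \<in> carrier B" for c x y
    using left_mult_hom that unfolding module_hom_def by blast+
  have zero: "left_mult \<zero>\<^bsub>B\<^esub> = \<zero>\<^bsub>E\<^esub>"
    using hom(2)[of "\<zero>\<^bsub>B\<^esub>" "\<zero>\<^bsub>B\<^esub>" "\<zero>\<^bsub>F\<^esub>"] E.lmult_0[OF left_mult_closed[OF B.zero_closed]]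
    by simp
  have R: "subspace F ?R B"
    unfolding restrict_filtration_def
  proof (rule B.subspaceI)
    show "\<zero>\<^bsub>B\<^esub> \<in> {b \<in> carrier B. left_mult b \<in> degree_filtration F E ?X (t * n)}"
      using D(2) zero by simp
  qed (auto simp: hom simp del: linear_endos_simps intro: D)
  show ?thesis
  proof (cases "n = 0")
    case True
    show ?thesis
    proof
      fix b assume b: "b \<in> \<beta> n"
      then have bB: "b \<in> carrier B" using \<beta> by (auto simp: filtration_def)
      obtain c where c: "c \<in> carrier F" "\<And>x. x \<in> carrier M \<Longrightarrow> act b x = c \<odot>\<^bsub>M\<^esub> x"
        using degree_0[of b] b True by auto
      have "left_mult b = c \<odot>\<^bsub>E\<^esub> \<one>\<^bsub>E\<^esub>"
        using c(2) by (auto simp: left_mult_def fun_eq_iff)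
      moreover have "\<one>\<^bsub>E\<^esub> \<in> degree_filtration F E ?X (t * n)"
        using E.word_in_degree_filtration[OF X, of "[]"] by simp
      ultimately have "left_mult b \<in> degree_filtration F E ?X (t * n)"
        using D(4)[OF c(1)] by metis
      then show "b \<in> ?R" using bB by (simp add: restrict_filtration_def)
    qed
  next
    case False
    have "{g i | i. i \<in> I \<and> d i = n} \<subseteq> ?R"
      using codeword_op_degree[of _ L "t * n"] L codeword_length g_closed
      by (auto simp: restrict_filtration_def)
    then have "B.span {g i | i. i \<in> I \<and> d i = n} \<subseteq> ?R"
      using R by (intro B.span_is_subset) (auto simp: subspace_def)
    then show ?thesis using g_span[of n] False by auto
  qed
qed

lemma countable_realization_of_filtration:
  assumes L: "countable L" "\<And>i. i \<in> I \<Longrightarrow> set (w i) \<subseteq> L"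
  shows "\<exists>(A :: ('f, nat \<Rightarrow> 'f) module) \<phi> T. assoc_algebra F A \<and> alg_embedding F B A \<phi> \<and>
    alg_generated_by F A (T ` L) \<and>
    (\<forall>n. \<beta> n \<subseteq> restrict_filtration B \<phi> (degree_filtration F A (T ` L)) (t * n) \<and>
         restrict_filtration B \<phi> (degree_filtration F A (T ` L)) n \<subseteq> \<beta> n)"
proof -
  have "left_mult ` carrier B \<subseteq> (\<Union>n. degree_filtration F E (letter_op ` L) n)"
  proof (rule image_subsetI)
    fix b assume "b \<in> carrier B"
    then obtain n where "b \<in> \<beta> n" using \<beta> unfolding filtration_def by blast
    then have "left_mult b \<in> degree_filtration F E (letter_op ` L) (t * n)"
      using subset_restriction[of L n] L(2) by (auto simp: restrict_filtration_def)
    then show "left_mult b \<in> (\<Union>n. degree_filtration F E (letter_op ` L) n)" by blast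
  qed
  moreover have "countable (letter_op ` L)" "letter_op ` L \<subseteq> carrier E"
    using L(1) letter_op_closed by auto
  ultimately obtain A :: "('f, nat \<Rightarrow> 'f) module" and \<psi> h where
    "assoc_algebra F A" "alg_embedding F B A \<psi>" "alg_generated_by F A (h ` letter_op ` L)"
    and eq: "restrict_filtration B \<psi> (degree_filtration F A (h ` letter_op ` L))
      = restrict_filtration B left_mult (degree_filtration F E (letter_op ` L))"
    using E.countable_realization[OF _ _ embedding] by metis
  moreover have "\<beta> n \<subseteq> restrict_filtration B \<psi> (degree_filtration F A (h ` letter_op ` L)) (t * n) \<and>
      restrict_filtration B \<psi> (degree_filtration F A (h ` letter_op ` L)) n \<subseteq> \<beta> n" for n
    unfolding eq using subset_restriction[of L n] restriction_subset[of L n] L(2) by blast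
  ultimately show ?thesis
    by (intro exI[of _ A] exI[of _ \<psi>] exI[of _ "h \<circ> letter_op"]) (auto simp: image_comp)
qed

end

section \<open>The module acted upon\<close>

lemma (in assoc_algebra) filtrationD:
  assumes "filtration F A \<beta>"
  shows "subspace F (\<beta> n) A" "\<beta> n \<subseteq> \<beta> (Suc n)" "\<beta> n \<subseteq> carrier A"
    "\<lbrakk>x \<in> \<beta> k; y \<in> \<beta> l\<rbrakk> \<Longrightarrow> x \<otimes>\<^bsub>A\<^esub> y \<in> \<beta> (k + l)"
  using assms unfolding filtration_def by blast+

lemma (in assoc_algebra) left_module_regular: "left_module F A A (\<lambda>b x. b \<otimes>\<^bsub>A\<^esub> x)"
  by unfold_locales (auto simp: r_distr l_distr smult_mult_left smult_mult_right m_assoc)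

text \<open>
  The action for the case \<open>\<beta> 0 = 0\<close>, in which \<open>1\<close> has to act as an idempotent different from the
  identity. It comes from adjoining a new unit \<open>e\<close> to \<open>B\<close> and letting \<open>B\<close> act on the result from the
  left: writing \<open>c e + y\<close> as the pair \<open>(c 1, y)\<close>, the formula says \<open>b (c e + y) = c b + b y\<close>. Taking
  all pairs in \<open>B \<times> B\<close> makes the space a direct sum.
\<close>

abbreviation nonunital_act :: "('f, 'b, 'n) module_scheme \<Rightarrow> 'b \<Rightarrow> 'b \<times> 'b \<Rightarrow> 'b \<times> 'b" where
  "nonunital_act B b p \<equiv> (\<zero>\<^bsub>B\<^esub>, b \<otimes>\<^bsub>B\<^esub> (fst p \<oplus>\<^bsub>B\<^esub> snd p))"

lemma (in assoc_algebra) left_module_nonunital: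
  "left_module F A (direct_sum A A) (nonunital_act A)"
proof -
  interpret M: vectorspace F "direct_sum A A"
    by (rule direct_sum_is_vs[OF vectorspace_axioms vectorspace_axioms])
  show ?thesis
    by unfold_locales
       (auto simp: direct_sum_def r_distr l_distr smult_r_distr smult_mult_left smult_mult_right m_assoc a_ac)
qed

text \<open>
  If \<open>1 \<in> \<beta> 0\<close>, the module is \<open>B\<close> itself, filtered by \<open>\<beta>\<close>, and \<open>m = 1\<close>. Otherwise \<open>\<beta> 0\<close> is a proper
  subspace of the line of scalars, hence zero, and the module with an adjoined unit is used, in which
  \<open>m = (1, 0)\<close> has weight \<open>0\<close> although \<open>1\<close> may have large degree in \<open>B\<close>.
\<close>

lemma filtration_realization:
  fixes B :: "('f, 'b, 'n) module_scheme" and w :: "'i \<Rightarrow> 'x list"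
  assumes B: "assoc_algebra F B" and \<beta>: "filtration F B \<beta>"
    and \<beta>0: "\<beta> 0 \<subseteq> module.span F B {\<one>\<^bsub>B\<^esub>}"
    and code: "overlap_free_code I w"
    and g: "\<And>i. i \<in> I \<Longrightarrow> g i \<in> \<beta> (d i)"
    and len: "\<And>i. i \<in> I \<Longrightarrow> d i \<le> length (w i) \<and> length (w i) \<le> t * d i"
    and span: "\<And>n. n \<ge> 1 \<Longrightarrow> \<beta> n \<subseteq> module.span F B {g i | i. i \<in> I \<and> d i = n}"
    and L: "countable L" "\<And>i. i \<in> I \<Longrightarrow> set (w i) \<subseteq> L"
  shows "\<exists>(A :: ('f, nat \<Rightarrow> 'f) module) \<phi> T. assoc_algebra F A \<and> alg_embedding F B A \<phi> \<and>
    alg_generated_by F A (T ` L) \<and>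
    (\<forall>n. \<beta> n \<subseteq> restrict_filtration B \<phi> (degree_filtration F A (T ` L)) (t * n) \<and>
         restrict_filtration B \<phi> (degree_filtration F A (T ` L)) n \<subseteq> \<beta> n)"
proof -
  interpret B: assoc_algebra F B by (rule B)
  interpret overlap_free_code I w by (rule code)
  note D = B.filtrationD[OF \<beta>] and S = B.subspaceD[OF B.filtrationD(1)[OF \<beta>]]
  have span1: "\<exists>c\<in>carrier F. b = c \<odot>\<^bsub>B\<^esub> \<one>\<^bsub>B\<^esub>" if "b \<in> B.span {\<one>\<^bsub>B\<^esub>}" for b
    using that by (auto elim: B.span_singletonE)
  have gB: "g i \<in> carrier B" if "i \<in> I" for i using g[OF that] D(3) by blast
  show ?thesis
  proof (cases "\<one>\<^bsub>B\<^esub> \<in> \<beta> 0")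
    case True
    interpret left_module F B B "\<lambda>b x. b \<otimes>\<^bsub>B\<^esub> x" by (rule B.left_module_regular)
    interpret stack_machine I w F B B "\<lambda>b x. b \<otimes>\<^bsub>B\<^esub> x" g
      by unfold_locales (rule gB)
    interpret filtered_stack_machine I w F B B "\<lambda>b x. b \<otimes>\<^bsub>B\<^esub> x" g d t \<beta> \<beta> "\<one>\<^bsub>B\<^esub>"
    proof (intro filtered_stack_machine.intro filtered_stack_machine_axioms.intro)
      fix b assume "b \<in> \<beta> 0"
      then obtain c where "c \<in> carrier F" "b = c \<odot>\<^bsub>B\<^esub> \<one>\<^bsub>B\<^esub>" using span1 \<beta>0 by blast
      then show "\<exists>c\<in>carrier F. \<forall>x\<in>carrier B. b \<otimes>\<^bsub>B\<^esub> x = c \<odot>\<^bsub>B\<^esub> x"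
        by (auto simp: B.smult_mult_left)
    next
      show "inj_on (\<lambda>b. b \<otimes>\<^bsub>B\<^esub> \<one>\<^bsub>B\<^esub>) (carrier B)" by (auto intro: inj_onI)
    qed (use \<beta> g len span True D stack_machine_axioms in auto)
    show ?thesis using L by (rule countable_realization_of_filtration)
  next
    case False
    have \<beta>0_trivial: "b = \<zero>\<^bsub>B\<^esub>" if b: "b \<in> \<beta> 0" for b
    proof (rule ccontr)
      assume nz: "b \<noteq> \<zero>\<^bsub>B\<^esub>"
      obtain c where c: "c \<in> carrier F" "b = c \<odot>\<^bsub>B\<^esub> \<one>\<^bsub>B\<^esub>" using span1 \<beta>0 b by blast
      with nz have "c \<noteq> \<zero>\<^bsub>F\<^esub>" by auto
      then have "\<one>\<^bsub>B\<^esub> = inv\<^bsub>F\<^esub> c \<odot>\<^bsub>B\<^esub> b" "inv\<^bsub>F\<^esub> c \<in> carrier F"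
        using B.inv_smult_cancel[OF c(1), of "\<one>\<^bsub>B\<^esub>"] c(2) by auto
      then show False using False S(4) b by metis
    qed
    let ?M = "direct_sum B B" and ?U = "B.span {\<one>\<^bsub>B\<^esub>}"
    have U: "subspace F ?U B" by (rule B.span_is_subspace) simp
    interpret left_module F B ?M "nonunital_act B" by (rule B.left_module_nonunital)
    interpret stack_machine I w F B ?M "nonunital_act B" g
      by unfold_locales (rule gB)
    interpret filtered_stack_machine I w F B ?M "nonunital_act B" g d t \<beta>
      "\<lambda>n. ?U \<times> \<beta> n" "(\<one>\<^bsub>B\<^esub>, \<zero>\<^bsub>B\<^esub>)"
    proof (intro filtered_stack_machine.intro filtered_stack_machine_axioms.intro)
      fix b assume "b \<in> \<beta> 0"
      then have "b = \<zero>\<^bsub>B\<^esub>" by (rule \<beta>0_trivial)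
      then show "\<exists>c\<in>carrier F. \<forall>x\<in>carrier ?M. nonunital_act B b x = c \<odot>\<^bsub>?M\<^esub> x"
        by (intro bexI[of _ "\<zero>\<^bsub>F\<^esub>"]) (auto simp: direct_sum_def)
    next
      fix n
      show "subspace F (?U \<times> \<beta> n) ?M"
      proof (intro subspace.intro submodule.intro)
        show "vectorspace F ?M" by (rule M.vectorspace_axioms)
        show "module F ?M" by (rule M.module_axioms)
        show "?U \<times> \<beta> n \<subseteq> carrier ?M"
          using B.subspaceD(1)[OF U] D(3)[of n] by (auto simp: direct_sum_def)
      qed (auto simp: direct_sum_def
          intro: B.subspaceD(2-4)[OF U] B.subspaceD(2-4)[OF D(1)])
    next
      fix b x k n assume b: "b \<in> \<beta> k" and x: "x \<in> ?U \<times> \<beta> n"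
      obtain y0 y where y: "x = (y0, y)" "y0 \<in> ?U" "y \<in> \<beta> n" using x by (rule SigmaE)
      obtain c where "c \<in> carrier F" "y0 = c \<odot>\<^bsub>B\<^esub> \<one>\<^bsub>B\<^esub>" using span1[OF y(2)] by (rule bexE)
      with y have cy: "c \<in> carrier F" "y \<in> \<beta> n" "x = (c \<odot>\<^bsub>B\<^esub> \<one>\<^bsub>B\<^esub>, y)" by simp_all
      have bB: "b \<in> carrier B" "y \<in> carrier B" using b cy D(3) by auto
      have "\<beta> k \<subseteq> \<beta> (k + n)" using D(2) by (rule lift_Suc_mono_le) simp
      then have "c \<odot>\<^bsub>B\<^esub> b \<oplus>\<^bsub>B\<^esub> b \<otimes>\<^bsub>B\<^esub> y \<in> \<beta> (k + n)"
        by (intro B.subspaceD(3,4)[OF D(1)] D(4) b cy subsetD[OF _ b])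
      moreover have "b \<otimes>\<^bsub>B\<^esub> (c \<odot>\<^bsub>B\<^esub> \<one>\<^bsub>B\<^esub> \<oplus>\<^bsub>B\<^esub> y) = c \<odot>\<^bsub>B\<^esub> b \<oplus>\<^bsub>B\<^esub> b \<otimes>\<^bsub>B\<^esub> y"
        using bB cy(1) by (simp add: B.r_distr B.smult_mult_right)
      ultimately show "nonunital_act B b x \<in> ?U \<times> \<beta> (k + n)"
        using B.subspaceD(2)[OF U] cy(3) by simp
    next
      show "(\<one>\<^bsub>B\<^esub>, \<zero>\<^bsub>B\<^esub>) \<in> ?U \<times> \<beta> 0"
        using S(2) B.in_own_span[of "{\<one>\<^bsub>B\<^esub>}"] by auto
    next
      show "inj_on (\<lambda>b. nonunital_act B b (\<one>\<^bsub>B\<^esub>, \<zero>\<^bsub>B\<^esub>)) (carrier B)"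
        by (auto intro: inj_onI)
    next
      show "?U \<times> \<beta> n \<subseteq> ?U \<times> \<beta> (Suc n)" for n using D(2)[of n] by blast
    qed (use \<beta> g len span D stack_machine_axioms in auto)
    show ?thesis using L by (rule countable_realization_of_filtration)
  qed
qed

section \<open>Two overlap-free codes\<close>

text \<open>
  Each digit is decorated by two flags that mark the first and the last letter of a codeword. The
  length is not changed, so this code realises the filtration exactly. The parameter tells
  whether the string starts a codeword.
\<close>

fun flagged :: "bool \<Rightarrow> nat list \<Rightarrow> (bool \<times> bool \<times> nat) list" where
  "flagged b [] = []"
| "flagged b [d] = [(b, True, d)]"
| "flagged b (d # d' # ds) = (b, False, d) # flagged False (d' # ds)"

lemma length_flagged [simp]: "length (flagged b ds) = length ds"
  by (induction b ds rule: flagged.induct) auto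

lemma set_flagged: "set (flagged b ds) \<subseteq> UNIV \<times> UNIV \<times> set ds"
  by (induction b ds rule: flagged.induct) auto

lemma fst_hd_flagged: "ds \<noteq> [] \<Longrightarrow> fst (hd (flagged b ds @ v)) = b"
  by (induction b ds rule: flagged.induct) auto

lemma fst_flagged_False: "x \<in> set (flagged False ds) \<Longrightarrow> \<not> fst x"
  by (induction False ds rule: flagged.induct) auto

lemma flagged_prefix_free:
  "ds \<noteq> [] \<Longrightarrow> es \<noteq> [] \<Longrightarrow> flagged b ds @ u = flagged b es @ v \<Longrightarrow> ds = es"
proof (induction b ds arbitrary: es rule: flagged.induct)
  case (2 b d)
  then show ?case by (cases "(b, es)" rule: flagged.cases) auto
next
  case (3 b d d' ds)
  then show ?case by (cases "(b, es)" rule: flagged.cases) auto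
qed auto

text \<open>
  A codeword starts with a letter whose first flag is set, and that flag is set nowhere else; so no
  proper suffix can match the start of a codeword. The last flag makes the code prefix-free.
\<close>

lemma overlap_free_flagged:
  "overlap_free_code {ds. ds \<noteq> [] \<and> set ds \<subseteq> D} (flagged True)"
proof
  fix i j p s u v
  assume i: "i \<in> {ds. ds \<noteq> [] \<and> set ds \<subseteq> D}" and j: "j \<in> {ds. ds \<noteq> [] \<and> set ds \<subseteq> D}"
    and w: "flagged True i = p @ s" and s: "s \<noteq> []" and eq: "s @ u = flagged True j @ v"
  have "fst (hd (s @ u))"
    unfolding eq using fst_hd_flagged[of j True v] j by simp
  then have hd: "fst (hd s)" using s by simp
  have p: "p = []"
  proof (rule ccontr)
    assume "p \<noteq> []"
    then obtain a p' where "p = a # p'" by (cases p) auto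
    then obtain d d' ds where "i = d # d' # ds" "flagged False (d' # ds) = p' @ s"
      using w i s by (cases "(True, i)" rule: flagged.cases) auto
    then show False using hd s fst_flagged_False[of "hd s" "d' # ds"] by auto
  qed
  then show "p = [] \<and> i = j"
    using eq w flagged_prefix_free[of i j True u v] i j by auto
next
  show "flagged True i \<noteq> []" if "i \<in> {ds. ds \<noteq> [] \<and> set ds \<subseteq> D}" for i
    using that length_flagged[of True i] by (auto simp del: length_flagged)
qed

text \<open>
  A self-delimiting binary code, with \<open>T\<close> and \<open>F\<close> for \<open>True\<close> and \<open>False\<close>: a digit \<open>d\<close> becomes \<open>d\<close> copies
  of \<open>FTFT\<close> closed by \<open>FTFF\<close>, and \<open>FF\<close> ends the string. Two adjacent \<open>True\<close> letters never occur, so \<open>TT\<close> is free to mark the start of a codeword.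
\<close>

primrec unary :: "nat list \<Rightarrow> bool list" where
  "unary [] = [False, False]"
| "unary (d # ds) = concat (replicate d [False, True, False, True]) @ [False, True, False, False] @ unary ds"

lemma unary_prefix_free: "unary ds @ u = unary es @ v \<Longrightarrow> ds = es"
proof (induction ds arbitrary: es)
  case Nil
  then show ?case
  proof (cases es)
    case (Cons e es')
    then show ?thesis using Nil by (cases e) auto
  qed simp
next
  case (Cons d ds)
  let ?R = "\<lambda>d. concat (replicate d [False, True, False, True])"
  have digit: "a = b \<and> xs = ys"
    if "?R a @ [False, True, False, False] @ xs = ?R b @ [False, True, False, False] @ ys" for a b xs ys
    using that
  proof (induction a arbitrary: b)
    case 0
    then show ?case by (cases b) auto
  next
    case (Suc a)
    then show ?case by (cases b) auto
  qed
  show ?case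
  proof (cases es)
    case Nil
    then show ?thesis using Cons.prems by (cases d) auto
  next
    case (Cons e es')
    then have "d = e \<and> unary ds @ u = unary es' @ v"
      using Cons.prems by (intro digit) simp
    then show ?thesis using Cons.IH Cons by auto
  qed
qed

lemma length_unary: "length (unary ds) = 2 + (\<Sum>d\<leftarrow>ds. 4 * d + 4)"
  by (induction ds) (auto simp: length_concat sum_list_replicate)

text \<open>
  No two adjacent letters are \<open>True\<close>, nor is the last one, so that \<open>TT\<close> cannot arise at the seam with
  the rest of the stack either.
\<close>

fun no_TT :: "bool list \<Rightarrow> bool" where
  "no_TT [] \<longleftrightarrow> True"
| "no_TT (False # xs) \<longleftrightarrow> no_TT xs"
| "no_TT [True] \<longleftrightarrow> False"
| "no_TT (True # x # xs) \<longleftrightarrow> \<not> x \<and> no_TT xs"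

lemma no_TT_tl: "no_TT (x # xs) \<Longrightarrow> no_TT xs"
  by (cases x; cases xs) auto

lemma no_TT_suffix: "no_TT (p @ s) \<Longrightarrow> no_TT s"
  by (induction p) (auto dest: no_TT_tl)

lemma no_TT_marker: "no_TT s \<Longrightarrow> s \<noteq> [] \<Longrightarrow> s @ u \<noteq> True # True # v"
  by (cases s rule: no_TT.cases) auto

lemma no_TT_unary: "no_TT (unary ds)"
proof (induction ds)
  case (Cons d ds)
  have "no_TT (True # concat (replicate d [False, True, False, True]) @ False # xs)" if "no_TT xs" for xs
    using that by (induction d) auto
  from no_TT_tl[OF this[of "True # False # False # unary ds"]] show ?case using Cons by simp
qed simp

text \<open>
  The marker \<open>TT\<close> occurs in a codeword only at its start.
\<close>

lemma overlap_free_unary: "overlap_free_code I (\<lambda>ds. True # True # unary ds)"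
proof
  fix i j p s u v
  assume w: "True # True # unary i = p @ s" and s: "s \<noteq> []"
    and eq: "s @ u = (True # True # unary j) @ v"
  have p: "p = []"
  proof (rule ccontr)
    assume "p \<noteq> []"
    then obtain p' where p': "True # unary i = p' @ s" using w by (cases p) auto
    have "no_TT (True # unary i)"
      using no_TT_unary[of i] by (cases i; cases "hd i") auto
    then have "no_TT s" unfolding p' by (rule no_TT_suffix)
    then show False using no_TT_marker[OF _ s, of u "unary j @ v"] eq by simp
  qed
  then show "p = [] \<and> i = j"
    using w eq unary_prefix_free[of i u j v] by (auto simp flip: w)
qed simp

section \<open>Tame filtrations as restrictions\<close>

text \<open>
  There are \<open>k^n\<close> digit strings of length \<open>n\<close> and fewer basis vectors of \<open>\<beta> n\<close>, so the strings can be
  mapped onto a basis, superfluous strings going to zero.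
\<close>

lemma tame_spanning_family:
  fixes B :: "('f, 'b, 'n) module_scheme"
  assumes B: "assoc_algebra F B" and \<beta>: "filtration F B \<beta>" and tame: "tame F B \<beta>"
  shows "\<exists>(g :: nat list \<Rightarrow> 'b) k. (\<forall>ds. ds \<noteq> [] \<longrightarrow> g ds \<in> \<beta> (length ds)) \<and>
    (\<forall>n\<ge>1. \<beta> n \<subseteq> module.span F B {g ds | ds. ds \<in> {ds. ds \<noteq> [] \<and> set ds \<subseteq> {..<k}} \<and> length ds = n})"
proof -
  interpret B: assoc_algebra F B by (rule B)
  note D = B.filtrationD[OF \<beta>]
  obtain c :: real where c: "c > 0"
    "\<And>n. n \<ge> 1 \<Longrightarrow> real (vectorspace.dim F (B\<lparr>carrier := \<beta> n\<rparr>)) < c ^ n"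
    using tame unfolding tame_def by blast
  obtain k :: nat where k: "c \<le> real k" using real_arch_simple by blast
  let ?L = "\<lambda>n. {ds. set ds \<subseteq> {..<k} \<and> length ds = n}"
  have "\<exists>h. h ` ?L n \<subseteq> \<beta> n \<and> \<beta> n \<subseteq> B.span (h ` ?L n)" if n: "n \<ge> 1" for n
  proof -
    interpret V: vectorspace F "B\<lparr>carrier := \<beta> n\<rparr>" using D(1) by (rule B.subspace_is_vs)
    have "V.fin_dim" using \<beta> by (simp add: filtration_def)
    then obtain E where E: "finite E" "V.basis E" using V.finite_basis_exists by blast
    then have E\<beta>: "E \<subseteq> \<beta> n" and "V.span E = \<beta> n" by (auto simp: V.basis_def)
    then have span: "B.span E = \<beta> n"
      using B.span_li_not_depend(1)[OF E\<beta>] D(1)[of n] by (simp add: subspace_def)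
    have "real (card E) < c ^ n" using c(2)[OF n] V.dim_basis[OF E] by simp
    also have "\<dots> \<le> real k ^ n" using k c(1) by (intro power_mono) auto
    also have "\<dots> = real (card (?L n))" by (simp add: card_lists_length_eq)
    finally have "card E \<le> card (?L n)" by simp
    then obtain f where f: "f ` E \<subseteq> ?L n" "inj_on f E"
      using card_le_inj[OF E(1) finite_lists_length_eq[OF finite_lessThan]] by blast
    define h where "h = (\<lambda>ds. if ds \<in> f ` E then inv_into E f ds else \<zero>\<^bsub>B\<^esub>)"
    have "h ` ?L n \<subseteq> \<beta> n"
      using E\<beta> B.subspaceD(2)[OF D(1)[of n]] by (auto simp: h_def inv_into_into subset_iff f(2))
    moreover have Eh: "E \<subseteq> h ` ?L n"
    proof
      fix e assume "e \<in> E"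
      then have "e = h (f e)" "f e \<in> ?L n" using f by (auto simp: h_def)
      then show "e \<in> h ` ?L n" by (rule image_eqI)
    qed
    moreover have "\<beta> n \<subseteq> B.span (h ` ?L n)"
      using B.span_is_monotone[OF Eh] unfolding span .
    ultimately show ?thesis by (intro exI[of _ h] conjI)
  qed
  then have ex: "\<forall>n. \<exists>h. n \<ge> 1 \<longrightarrow> h ` ?L n \<subseteq> \<beta> n \<and> \<beta> n \<subseteq> B.span (h ` ?L n)" by simp
  obtain h where h: "\<And>n. n \<ge> 1 \<Longrightarrow> h n ` ?L n \<subseteq> \<beta> n"
      "\<And>n. n \<ge> 1 \<Longrightarrow> \<beta> n \<subseteq> B.span (h n ` ?L n)"
    using choice[OF ex] by blast
  define g where "g = (\<lambda>ds. if set ds \<subseteq> {..<k} then h (length ds) ds else \<zero>\<^bsub>B\<^esub>)"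
  show ?thesis
  proof (intro exI conjI allI impI)
    fix ds :: "nat list" assume "ds \<noteq> []"
    then show "g ds \<in> \<beta> (length ds)"
      using h(1)[of "length ds"] B.subspaceD(2)[OF D(1)] by (cases ds) (auto simp: g_def image_subset_iff)
  next
    fix n :: nat assume n: "n \<ge> 1"
    have "h n ` ?L n = {g ds | ds. ds \<in> {ds. ds \<noteq> [] \<and> set ds \<subseteq> {..<k}} \<and> length ds = n}"
      using n by (auto simp: g_def image_def)
    then show "\<beta> n \<subseteq> B.span {g ds | ds. ds \<in> {ds. ds \<noteq> [] \<and> set ds \<subseteq> {..<k}} \<and> length ds = n}"
      using h(2)[OF n] by simp
  qed
qed

lemma tame_imp_eq_restriction_fin_gen:
  fixes B :: "('f, 'b, 'n) module_scheme"
  assumes B: "assoc_algebra F B" and \<beta>: "filtration F B \<beta>"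
    and \<beta>0: "\<beta> 0 \<subseteq> module.span F B {\<one>\<^bsub>B\<^esub>}" and tame: "tame F B \<beta>"
  shows "\<exists>A :: ('f, nat \<Rightarrow> 'f) module. eq_restriction_fin_gen F B \<beta> A"
proof -
  obtain g :: "nat list \<Rightarrow> 'b" and k :: nat where g: "\<And>ds. ds \<noteq> [] \<Longrightarrow> g ds \<in> \<beta> (length ds)"
    "\<And>n. n \<ge> 1 \<Longrightarrow>
      \<beta> n \<subseteq> module.span F B {g ds | ds. ds \<in> {ds. ds \<noteq> [] \<and> set ds \<subseteq> {..<k}} \<and> length ds = n}"
    using tame_spanning_family[OF B \<beta> tame] by blast
  let ?L = "UNIV \<times> UNIV \<times> {..<k} :: (bool \<times> bool \<times> nat) set"
  have L: "finite ?L" by simp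
  have "\<exists>(A :: ('f, nat \<Rightarrow> 'f) module) \<phi> T. assoc_algebra F A \<and> alg_embedding F B A \<phi> \<and>
    alg_generated_by F A (T ` ?L) \<and>
    (\<forall>n. \<beta> n \<subseteq> restrict_filtration B \<phi> (degree_filtration F A (T ` ?L)) (1 * n) \<and>
         restrict_filtration B \<phi> (degree_filtration F A (T ` ?L)) n \<subseteq> \<beta> n)"
  proof (rule filtration_realization[OF B \<beta> \<beta>0 overlap_free_flagged _ _ g(2)])
    show "set (flagged True ds) \<subseteq> ?L" if "ds \<in> {ds. ds \<noteq> [] \<and> set ds \<subseteq> {..<k}}" for ds
      using set_flagged[of True ds] that by auto
  qed (use g(1) L in \<open>auto intro: countable_finite\<close>)
  then obtain A :: "('f, nat \<Rightarrow> 'f) module" and \<phi> T where A: "assoc_algebra F A"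
      "alg_embedding F B A \<phi>" "alg_generated_by F A (T ` ?L)"
    and eq: "\<And>n. \<beta> n = restrict_filtration B \<phi> (degree_filtration F A (T ` ?L)) n"
    by (metis mult_1 subset_antisym)
  have "\<beta> = restrict_filtration B \<phi> (degree_filtration F A (T ` ?L))"
    by (rule ext) (rule eq)
  then show ?thesis
    unfolding eq_restriction_fin_gen_def using A finite_imageI[OF L] by blast
qed

lemma tame_imp_equiv_restriction_2_generator:
  fixes B :: "('f, 'b, 'n) module_scheme"
  assumes B: "assoc_algebra F B" and \<beta>: "filtration F B \<beta>"
    and \<beta>0: "\<beta> 0 \<subseteq> module.span F B {\<one>\<^bsub>B\<^esub>}" and tame: "tame F B \<beta>"
  shows "\<exists>A :: ('f, nat \<Rightarrow> 'f) module. equiv_restriction_2_generator F B \<beta> A"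
proof -
  interpret B: assoc_algebra F B by (rule B)
  obtain g :: "nat list \<Rightarrow> 'b" and k :: nat where g: "\<And>ds. ds \<noteq> [] \<Longrightarrow> g ds \<in> \<beta> (length ds)"
    "\<And>n. n \<ge> 1 \<Longrightarrow>
      \<beta> n \<subseteq> module.span F B {g ds | ds. ds \<in> {ds. ds \<noteq> [] \<and> set ds \<subseteq> {..<k}} \<and> length ds = n}"
    using tame_spanning_family[OF B \<beta> tame] by blast
  let ?I = "{ds. ds \<noteq> [] \<and> set ds \<subseteq> {..<k}}"
  \<comment> \<open>A digit below \<open>k\<close> costs at most \<open>4 k\<close> letters; marker and end of the string cost \<open>4\<close> letters more.\<close>
  define t where "t = 4 * k + 4"
  have len: "length ds \<le> length (True # True # unary ds) \<and> length (True # True # unary ds) \<le> t * length ds"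
    if "ds \<in> ?I" for ds
  proof
    have "(\<Sum>d\<leftarrow>ds. 1) \<le> (\<Sum>d\<leftarrow>ds. 4 * d + 4)" by (rule sum_list_mono) simp
    then show "length ds \<le> length (True # True # unary ds)"
      by (simp add: length_unary sum_list_triv)
    have "(\<Sum>d\<leftarrow>ds. 4 * d + 4) \<le> (\<Sum>d\<leftarrow>ds. 4 * k)"
      using that by (intro sum_list_mono) (auto simp: subset_iff Suc_le_eq)
    then have "(\<Sum>d\<leftarrow>ds. 4 * d + 4) \<le> length ds * (4 * k)"
      by (simp add: sum_list_triv)
    moreover have "length ds \<ge> 1" using that by (cases ds) auto
    ultimately show "length (True # True # unary ds) \<le> t * length ds"
      by (simp add: length_unary t_def algebra_simps)
  qed
  have "\<exists>(A :: ('f, nat \<Rightarrow> 'f) module) \<phi> T. assoc_algebra F A \<and> alg_embedding F B A \<phi> \<and>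
    alg_generated_by F A (T ` {True, False}) \<and>
    (\<forall>n. \<beta> n \<subseteq> restrict_filtration B \<phi> (degree_filtration F A (T ` {True, False})) (t * n) \<and>
         restrict_filtration B \<phi> (degree_filtration F A (T ` {True, False})) n \<subseteq> \<beta> n)"
    by (rule filtration_realization[OF B \<beta> \<beta>0 overlap_free_unary[of ?I] _ len g(2)])
       (use g(1) in auto)
  then obtain A :: "('f, nat \<Rightarrow> 'f) module" and \<phi> T where A: "assoc_algebra F A"
      "alg_embedding F B A \<phi>" "alg_generated_by F A {T True, T False}"
    and sub: "\<And>n. \<beta> n \<subseteq> restrict_filtration B \<phi> (degree_filtration F A {T True, T False}) (t * n)"
      "\<And>n. restrict_filtration B \<phi> (degree_filtration F A {T True, T False}) n \<subseteq> \<beta> n"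
    unfolding image_insert image_empty by blast
  have "\<beta> n \<subseteq> \<beta> (t * n)" for n
    using B.filtrationD(2)[OF \<beta>] by (rule lift_Suc_mono_le) (simp add: t_def)
  with sub have "filtration_equiv \<beta> (restrict_filtration B \<phi> (degree_filtration F A {T True, T False}))"
    unfolding filtration_equiv_def by (intro exI[of _ t]) (auto simp: t_def)
  with A show ?thesis unfolding equiv_restriction_2_generator_def by blast
qed

lemma equiv_restriction_2_generator_imp_tame:
  assumes B: "assoc_algebra F B" and \<beta>: "filtration F B \<beta>"
    and "equiv_restriction_2_generator F B \<beta> A"
  shows "tame F B \<beta>"
proof -
  obtain \<phi> x y t where A: "assoc_algebra F A" "alg_embedding F B A \<phi>" "alg_generated_by F A {x, y}"
    and sub: "\<And>n. \<beta> n \<subseteq> restrict_filtration B \<phi> (degree_filtration F A {x, y}) (t * n)"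
    using assms(3) unfolding equiv_restriction_2_generator_def filtration_equiv_def by blast
  show ?thesis
    using A by (intro tame_if_dominated_by_degree_filtration[OF A(1) B \<beta> A(2) _ _ sub])
      (auto simp: alg_generated_by_def)
qed

lemma eq_restriction_fin_gen_imp_tame:
  assumes B: "assoc_algebra F B" and \<beta>: "filtration F B \<beta>"
    and "eq_restriction_fin_gen F B \<beta> A"
  shows "tame F B \<beta>"
proof -
  obtain \<phi> X where A: "assoc_algebra F A" "alg_embedding F B A \<phi>" "finite X" "alg_generated_by F A X"
    and eq: "\<beta> = restrict_filtration B \<phi> (degree_filtration F A X)"
    using assms(3) unfolding eq_restriction_fin_gen_def by blast
  have "\<beta> n \<subseteq> restrict_filtration B \<phi> (degree_filtration F A X) (1 * n)" for n
    using eq by simp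
  moreover have "X \<subseteq> carrier A" using A(4) by (simp add: alg_generated_by_def)
  ultimately show ?thesis
    using tame_if_dominated_by_degree_filtration[OF A(1) B \<beta> A(2,3)] by blast
qed

theorem theorem7:
  fixes F :: "('f, 'm) ring_scheme"
    and B :: "('f, 'b, 'n) module_scheme"
    and \<beta> :: "nat \<Rightarrow> 'b set"
  assumes "assoc_algebra F B"
    and "filtration F B \<beta>"
    and "\<beta> 0 \<subseteq> module.span F B {\<one>\<^bsub>B\<^esub>}"
  shows
    "(tame F B \<beta> \<longleftrightarrow>
        (\<exists>A :: ('f, nat \<Rightarrow> 'f) module. equiv_restriction_2_generator F B \<beta> A)) \<and>
     (\<forall>A :: ('f, 'a, 'k) module_scheme.
        equiv_restriction_2_generator F B \<beta> A \<longrightarrow> tame F B \<beta>) \<and>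
     (tame F B \<beta> \<longleftrightarrow>
        (\<exists>A :: ('f, nat \<Rightarrow> 'f) module. eq_restriction_fin_gen F B \<beta> A)) \<and>
     (\<forall>A :: ('f, 'a, 'k) module_scheme.
        eq_restriction_fin_gen F B \<beta> A \<longrightarrow> tame F B \<beta>)"
  by (intro conjI iffI allI impI; (elim exE)?)
    (erule tame_imp_equiv_restriction_2_generator[OF assms] tame_imp_eq_restriction_fin_gen[OF assms]
      equiv_restriction_2_generator_imp_tame[OF assms(1,2)] eq_restriction_fin_gen_imp_tame[OF assms(1,2)])+

end
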